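(* The class of groups which admit a proper quasi-1-cocycle with values in an infinite sum of the regular representation is closed under $\ell^2$-orbit equivalence. That is: if $G$ and $H$ are $\ell^2$-orbit equivalent finitely generated discrete groups and $G$ admits a proper quasi-1-cocycle $G\to \ell^2G^{\oplus\infty}$, then $H$ admits a proper quasi-1-cocycle $H\to\ell^2H^{\oplus\infty}$.
   Context: $\ell^2 G$ is the Hilbert space with orthonormal basis $G$ with the left regular representation; $\ell^2G^{\oplus\infty}$ is the Hilbert space direct sum of countably infinitely many copies. For a unitary representation $\pi\colon G\to U(H_\pi)$, a quasi-1-cocycle is a map $c\colon G\to H_\pi$ such that $(g,h)\mapsto \pi(g)c(h)-c(gh)+c(g)$ is uniformly bounded on $G\times G$. It is proper if $\{g\in G: \|c(g)\|\le R\}$ is finite for every $R>0$. Let $(X,\mu)$ be a standard probability space and $G\curvearrowright(X,\mu)$ a measure preserving action by Borel automorphisms. All equalities of sets and partial maps are up to null sets. $X\rtimes G$ denotes the inverse semigroup of partial isomorphisms implemented by the action (not just the equivalence relation). Every partial isomorphism in it can be written as an infinite orthogonal sum $\phi=\bigoplus_{i=1}^\infty \chi_{A_i}g_i$ with $g_i\in G$ and Borel sets $A_i\subset X$, where $\chi_{A}g$ denotes the restriction of $g$ to $g^{-1}A$ (with range $A$), and orthogonality means that the ranges $A_i$ are pairwise disjoint and the domains $g_i^{-1}A_i$ are pairwise disjoint. If $G$ is finitely generated with word length function $l\colon G\to\mathbb N$, then $X\rtimes_2G$ is the sub-inverse-semigroup formed by those $\phi=\bigoplus_i\chi_{A_i}g_i$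 with $\sum_i\mu(A_i)\,l(g_i)^2<\infty$ (the summability does not depend on the finite generating set). Let $G$ and $H$ act on the same standard probability space $(X,\mu)$ by measure preserving actions by Borel automorphisms. The data is said to induce an orbit equivalence if the orbits of the two actions agree up to measure zero. In this case, natural injective homomorphisms of inverse semigroups $\phi_1\colon G\to X\rtimes H$ and $\phi_2\colon H\to X\rtimes G$ are defined (expressing the automorphism given by an element of one group piecewise by elements of the other). The orbit equivalence is an $\ell^2$-orbit equivalence if $\phi_1(G)\subset X\rtimes_2H$ and $\phi_2(H)\subset X\rtimes_2G$. The groups $G$ and $H$ are $\ell^2$-orbit equivalent if such actions exist.
   Formalization: Both measure preserving actions in the orbit equivalence are assumed essentially free; without this the natural maps into X⋊G and X⋊H are not well defined, and the claim fails for faithful non-free actions such as ℤ and SL₃(ℤ) on a union of finite quotients. *)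

theory Defs
  imports
    "HOL-Probability.Probability"
    "HOL-Algebra.Generated_Groups"
    "HOL-Algebra.Group_Action"
    "HOL-Library.Function_Algebras"
begin

section \<open>Finitely generated groups and word length\<close>

definition finite_generating_set :: "('g, 'a) monoid_scheme \<Rightarrow> 'g set \<Rightarrow> bool" where
  "finite_generating_set G S \<longleftrightarrow> finite S \<and> S \<subseteq> carrier G \<and> generate G S = carrier G"

definition finitely_generated_group :: "('g, 'a) monoid_scheme \<Rightarrow> bool" where
  "finitely_generated_group G \<longleftrightarrow> group G \<and> (\<exists>S. finite_generating_set G S)"

definition word_length :: "('g, 'a) monoid_scheme \<Rightarrow> 'g set \<Rightarrow> 'g \<Rightarrow> nat" where
  "word_length G S g =
     (LEAST n. \<exists>w. length w = n \<and> set w \<subseteq> S \<union> m_inv G ` S \<and> foldr (mult G) w (one G) = g)"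

section \<open>Quasi-1-cocycles\<close>

text \<open>A representation space is given by a carrier \<open>V\<close>, a norm \<open>nrm\<close> on it and the maps
  \<open>rep g\<close>. The algebraic operations are those of the ambient type; on function types they are
  the pointwise ones.\<close>

definition quasi_cocycle ::
  "('g, 'a) monoid_scheme \<Rightarrow> 'v::ab_group_add set \<Rightarrow> ('v \<Rightarrow> real) \<Rightarrow> ('g \<Rightarrow> 'v \<Rightarrow> 'v) \<Rightarrow> ('g \<Rightarrow> 'v) \<Rightarrow> bool"
  where
  "quasi_cocycle G V nrm rep c \<longleftrightarrow>
     (\<forall>g\<in>carrier G. c g \<in> V) \<and>
     (\<exists>K. \<forall>g\<in>carrier G. \<forall>h\<in>carrier G. nrm (rep g (c h) - c (g \<otimes>\<^bsub>G\<^esub> h) + c g) \<le> K)"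

definition proper_map :: "('g, 'a) monoid_scheme \<Rightarrow> ('v \<Rightarrow> real) \<Rightarrow> ('g \<Rightarrow> 'v) \<Rightarrow> bool" where
  "proper_map G nrm c \<longleftrightarrow> (\<forall>R>0. finite {g \<in> carrier G. nrm (c g) \<le> R})"

section \<open>The infinite sum of the regular representation\<close>

text \<open>Elements of \<open>\<ell>\<^sup>2G\<close> are functions on the whole type that vanish off \<open>carrier G\<close>, so that
  equality of vectors is equality of functions.\<close>

definition ell2 :: "('g, 'a) monoid_scheme \<Rightarrow> ('g \<Rightarrow> complex) set" where
  "ell2 G = {\<xi>. (\<forall>x. x \<notin> carrier G \<longrightarrow> \<xi> x = 0) \<and> (\<lambda>x. (cmod (\<xi> x))\<^sup>2) summable_on carrier G}"

definition ell2_norm :: "('g, 'a) monoid_scheme \<Rightarrow> ('g \<Rightarrow> complex) \<Rightarrow> real" where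
  "ell2_norm G \<xi> = sqrt (\<Sum>\<^sub>\<infinity>x\<in>carrier G. (cmod (\<xi> x))\<^sup>2)"

definition left_regular :: "('g, 'a) monoid_scheme \<Rightarrow> 'g \<Rightarrow> ('g \<Rightarrow> complex) \<Rightarrow> ('g \<Rightarrow> complex)" where
  "left_regular G g \<xi> = (\<lambda>x. if x \<in> carrier G then \<xi> (inv\<^bsub>G\<^esub> g \<otimes>\<^bsub>G\<^esub> x) else 0)"

definition ell2_sum :: "('g, 'a) monoid_scheme \<Rightarrow> (nat \<Rightarrow> 'g \<Rightarrow> complex) set" where
  "ell2_sum G = {\<xi>. (\<forall>n. \<xi> n \<in> ell2 G) \<and> summable (\<lambda>n. (ell2_norm G (\<xi> n))\<^sup>2)}"

definition ell2_sum_norm :: "('g, 'a) monoid_scheme \<Rightarrow> (nat \<Rightarrow> 'g \<Rightarrow> complex) \<Rightarrow> real" where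
  "ell2_sum_norm G \<xi> = sqrt (\<Sum>n. (ell2_norm G (\<xi> n))\<^sup>2)"

definition left_regular_sum ::
  "('g, 'a) monoid_scheme \<Rightarrow> 'g \<Rightarrow> (nat \<Rightarrow> 'g \<Rightarrow> complex) \<Rightarrow> (nat \<Rightarrow> 'g \<Rightarrow> complex)" where
  "left_regular_sum G g \<xi> = (\<lambda>n. left_regular G g (\<xi> n))"

definition admits_proper_quasi_cocycle :: "('g, 'a) monoid_scheme \<Rightarrow> bool" where
  "admits_proper_quasi_cocycle G \<longleftrightarrow>
     (\<exists>c. quasi_cocycle G (ell2_sum G) (ell2_sum_norm G) (left_regular_sum G) c \<and>
          proper_map G (ell2_sum_norm G) c)"

lemma left_regular_ell2:
  assumes "group G" "g \<in> carrier G" "\<xi> \<in> ell2 G"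
  shows "left_regular G g \<xi> \<in> ell2 G" "ell2_norm G (left_regular G g \<xi>) = ell2_norm G \<xi>"
proof -
  interpret group G by fact
  have bij: "bij_betw (\<lambda>x. inv\<^bsub>G\<^esub> g \<otimes>\<^bsub>G\<^esub> x) (carrier G) (carrier G)"
    using assms(2)
    by (intro bij_betw_byWitness[where f' = "\<lambda>x. g \<otimes>\<^bsub>G\<^esub> x"]) (auto simp: m_assoc[symmetric])
  let ?f = "\<lambda>x. (cmod (\<xi> x))\<^sup>2"
  have "(\<lambda>x. ?f (inv\<^bsub>G\<^esub> g \<otimes>\<^bsub>G\<^esub> x)) summable_on carrier G"
    using summable_on_reindex_bij_betw[OF bij, of ?f] assms(3) by (simp add: ell2_def)
  then have "(\<lambda>x. (cmod (left_regular G g \<xi> x))\<^sup>2) summable_on carrier G"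
    by (rule summable_on_cong[THEN iffD1, rotated]) (simp add: left_regular_def)
  then show "left_regular G g \<xi> \<in> ell2 G"
    by (simp add: ell2_def left_regular_def)
  have "(\<Sum>\<^sub>\<infinity>x\<in>carrier G. (cmod (left_regular G g \<xi> x))\<^sup>2)
      = (\<Sum>\<^sub>\<infinity>x\<in>carrier G. ?f (inv\<^bsub>G\<^esub> g \<otimes>\<^bsub>G\<^esub> x))"
    by (rule infsum_cong) (simp add: left_regular_def)
  also have "\<dots> = (\<Sum>\<^sub>\<infinity>x\<in>carrier G. ?f x)"
    by (rule infsum_reindex_bij_betw[OF bij])
  finally show "ell2_norm G (left_regular G g \<xi>) = ell2_norm G \<xi>"
    by (simp add: ell2_norm_def)
qed

section \<open>Measure preserving actions and the inverse semigroup of partial isomorphisms\<close>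

definition standard_probability_space :: "'x measure \<Rightarrow> bool" where
  "standard_probability_space M \<longleftrightarrow>
     prob_space M \<and>
     (\<exists>T. completely_metrizable_space T \<and> second_countable T \<and> topspace T = space M \<and>
          sets M = sigma_sets (space M) {U. openin T U})"

definition mp_action :: "('g, 'a) monoid_scheme \<Rightarrow> 'x measure \<Rightarrow> ('g \<Rightarrow> 'x \<Rightarrow> 'x) \<Rightarrow> bool" where
  "mp_action G M act \<longleftrightarrow>
     group_action G (space M) act \<and>
     (\<forall>g\<in>carrier G. act g \<in> M \<rightarrow>\<^sub>M M \<and> distr M M (act g) = M)"

definition essentially_free :: "('g, 'a) monoid_scheme \<Rightarrow> 'x measure \<Rightarrow> ('g \<Rightarrow> 'x \<Rightarrow> 'x) \<Rightarrow> bool" where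
  "essentially_free G M act \<longleftrightarrow>
     (AE x in M. \<forall>g\<in>carrier G. act g x = x \<longrightarrow> g = \<one>\<^bsub>G\<^esub>)"

text \<open>\<open>\<chi>\<^sub>A g\<close>: the restriction of \<open>g\<close> to \<open>g\<inverse> A\<close>, with range \<open>A\<close>.\<close>

definition cut :: "'x measure \<Rightarrow> ('g \<Rightarrow> 'x \<Rightarrow> 'x) \<Rightarrow> 'x set \<Rightarrow> 'g \<Rightarrow> ('x \<rightharpoonup> 'x)" where
  "cut M act A g = (\<lambda>x. if x \<in> space M \<and> act g x \<in> A then Some (act g x) else None)"

text \<open>\<open>f = \<Oplus>\<^sub>i \<chi>\<^bsub>A i\<^esub> (g i)\<close> up to null sets, the sum being orthogonal. Finite sums are the case
  in which almost all \<open>A i\<close> are empty.\<close>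

definition orthogonal_sum ::
  "('g, 'a) monoid_scheme \<Rightarrow> 'x measure \<Rightarrow> ('g \<Rightarrow> 'x \<Rightarrow> 'x) \<Rightarrow> (nat \<Rightarrow> 'x set) \<Rightarrow> (nat \<Rightarrow> 'g) \<Rightarrow>
   ('x \<rightharpoonup> 'x) \<Rightarrow> bool" where
  "orthogonal_sum G M act A g f \<longleftrightarrow>
     (\<forall>i. A i \<in> sets M \<and> g i \<in> carrier G) \<and>
     disjoint_family A \<and> disjoint_family (\<lambda>i. dom (cut M act (A i) (g i))) \<and>
     (AE x in M. \<forall>y. f x = Some y \<longleftrightarrow> (\<exists>i. cut M act (A i) (g i) x = Some y))"

text \<open>\<open>X \<rtimes> G\<close> and \<open>X \<rtimes>\<^sub>2 G\<close>. Elements are represented by partial maps, and membership only depends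
  on the class of the map up to null sets. Summability does not depend on the generating set.\<close>

definition crossed :: "'x measure \<Rightarrow> ('g, 'a) monoid_scheme \<Rightarrow> ('g \<Rightarrow> 'x \<Rightarrow> 'x) \<Rightarrow> ('x \<rightharpoonup> 'x) set" where
  "crossed M G act = {f. \<exists>A g. orthogonal_sum G M act A g f}"

definition crossed2 :: "'x measure \<Rightarrow> ('g, 'a) monoid_scheme \<Rightarrow> ('g \<Rightarrow> 'x \<Rightarrow> 'x) \<Rightarrow> ('x \<rightharpoonup> 'x) set" where
  "crossed2 M G act = {f \<in> crossed M G act. \<exists>S A g. finite_generating_set G S \<and>
     orthogonal_sum G M act A g f \<and>
     summable (\<lambda>i. measure M (A i) * (real (word_length G S (g i)))\<^sup>2)}"

section \<open>Orbit equivalence\<close>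

text \<open>Essential freeness is what makes the maps \<open>\<phi>\<^sub>1\<close>, \<open>\<phi>\<^sub>2\<close> below injective and the expression of a
  partial isomorphism by group elements unique up to null sets (so that a partial isomorphism in
  \<open>X \<rtimes> G\<close> determines the group elements implementing it).\<close>

definition orbit_equivalence ::
  "'x measure \<Rightarrow> ('g, 'a) monoid_scheme \<Rightarrow> ('g \<Rightarrow> 'x \<Rightarrow> 'x) \<Rightarrow> ('h, 'b) monoid_scheme \<Rightarrow>
   ('h \<Rightarrow> 'x \<Rightarrow> 'x) \<Rightarrow> bool" where
  "orbit_equivalence M G actG H actH \<longleftrightarrow>
     standard_probability_space M \<and>
     mp_action G M actG \<and> mp_action H M actH \<and>
     essentially_free G M actG \<and> essentially_free H M actH \<and>
     (AE x in M. orbit G actG x = orbit H actH x)"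

text \<open>The map \<open>\<phi>\<^sub>1\<close> sends \<open>g\<close> to the automorphism \<open>\<chi>\<^sub>X g\<close>, regarded as an element of \<open>X \<rtimes> H\<close>;
  likewise for \<open>\<phi>\<^sub>2\<close>.\<close>

definition natural_map :: "'x measure \<Rightarrow> ('g \<Rightarrow> 'x \<Rightarrow> 'x) \<Rightarrow> 'g \<Rightarrow> ('x \<rightharpoonup> 'x)" where
  "natural_map M act g = cut M act (space M) g"

definition l2_orbit_equivalence ::
  "'x measure \<Rightarrow> ('g, 'a) monoid_scheme \<Rightarrow> ('g \<Rightarrow> 'x \<Rightarrow> 'x) \<Rightarrow> ('h, 'b) monoid_scheme \<Rightarrow>
   ('h \<Rightarrow> 'x \<Rightarrow> 'x) \<Rightarrow> bool" where
  "l2_orbit_equivalence M G actG H actH \<longleftrightarrow>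
     orbit_equivalence M G actG H actH \<and>
     natural_map M actG ` carrier G \<subseteq> crossed2 M H actH \<and>
     natural_map M actH ` carrier H \<subseteq> crossed2 M G actG"

text \<open>The type argument is the type of points of the space; leaving it a free type variable in a
  hypothesis amounts to an existential quantification over all spaces.\<close>

definition l2_orbit_equivalent ::
  "'x itself \<Rightarrow> ('g, 'a) monoid_scheme \<Rightarrow> ('h, 'b) monoid_scheme \<Rightarrow> bool" where
  "l2_orbit_equivalent _ G H \<longleftrightarrow>
     (\<exists>(M :: 'x measure) actG actH. l2_orbit_equivalence M G actG H actH)"

end

theory Submission
  imports Defs
begin

text \<open>Let \<open>c\<close> be a proper quasi-cocycle on \<open>G\<close>. Orbit equivalence and freeness give the orbit cocycle
\<open>\<alpha> : H \<times> X \<rightarrow> G\<close> with \<open>\<alpha>(h, x) x = h x\<close>, and \<open>H\<close> acts on \<open>L\<^sup>2(X, \<ell>\<^sup>2G\<^bsup>\<oplus>\<infinity>\<^esup>)\<close> by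
\<open>(h \<cdot> \<xi>)(x) = \<lambda>(\<alpha>(h, h\<inverse> x)) (\<xi> (h\<inverse> x))\<close>. The induced map \<open>c'(h)(x) = c(\<alpha>(h, h\<inverse> x))\<close> satisfies the
quasi-cocycle identity pointwise in \<open>x\<close> with the bound of \<open>c\<close>, and since \<open>X\<close> has measure one the same
bound holds in \<open>L\<^sup>2\<close>. That \<open>c'(h)\<close> is square integrable is the \<open>\<ell>\<^sup>2\<close>-condition: \<open>\<parallel>c g\<parallel>\<close> grows at
most linearly in the word length (\<open>quasi_cocycle_growth\<close>), and the word length of \<open>\<alpha>(h, x)\<close> is square
integrable in \<open>x\<close> (\<open>crossed2_label\<close>). Properness survives because the elements \<open>\<alpha>(h, x)\<close> are pairwise
distinct for fixed \<open>x\<close>, so that at each point only a bounded number of \<open>h\<close> can have \<open>c(\<alpha>(h, x))\<close> small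
(\<open>transport_proper\<close>).

It remains to recognise the induced representation as a multiple of the regular representation of
\<open>H\<close>. The space \<open>L\<^sup>2(X, \<ell>\<^sup>2G)\<close> is \<open>L\<^sup>2\<close> of the orbit relation, \<open>(x, g)\<close> standing for
\<open>(x, g\<inverse> x)\<close>, and \<open>H\<close> moves only the first point. Parametrised by \<open>H\<close> instead of \<open>G\<close>, as
\<open>(k y, y)\<close>, it is \<open>\<ell>\<^sup>2H \<otimes> L\<^sup>2(X)\<close> with \<open>H\<close> acting on the first factor (\<open>untwist_isometry\<close> for the
norms, \<open>untwist_defect\<close> for the action). Finally \<open>L\<^sup>2(X)\<close> is replaced by \<open>\<ell>\<^sup>2\<close>: the coefficients of
\<open>c'\<close> are countably many functions, and Gram-Schmidt provides sequences with the same inner products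
(\<open>L2_family_in_ell2\<close>).\<close>

section \<open>Words in a generating set\<close>

lemma (in group) word_closed:
  assumes "S \<subseteq> carrier G" "set w \<subseteq> S \<union> m_inv G ` S"
  shows "foldr (mult G) w \<one> \<in> carrier G"
  using assms(2) by (induction w) (use assms(1) in auto)

lemma (in group) foldr_mult_append:
  assumes "set u \<subseteq> carrier G" "set w \<subseteq> carrier G"
  shows "foldr (mult G) (u @ w) \<one> = foldr (mult G) u \<one> \<otimes> foldr (mult G) w \<one>"
proof -
  have cl: "foldr (mult G) v \<one> \<in> carrier G" if "set v \<subseteq> carrier G" for v
    using that by (induction v) auto
  show ?thesis
    using assms(1) by (induction u) (auto simp: cl assms(2) m_assoc)
qed

lemma (in group) exists_word:
  assumes "S \<subseteq> carrier G" "g \<in> generate G S"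
  shows "\<exists>w. set w \<subseteq> S \<union> m_inv G ` S \<and> foldr (mult G) w \<one> = g"
  using assms(2)
proof induction
  case one
  show ?case by (rule exI[of _ "[]"]) simp
next
  case (incl h)
  then show ?case using assms(1) by (intro exI[of _ "[h]"]) auto
next
  case (inv h)
  then show ?case using assms(1) by (intro exI[of _ "[inv h]"]) auto
next
  case (eng h1 h2)
  then obtain u w where "set u \<subseteq> S \<union> m_inv G ` S" "foldr (mult G) u \<one> = h1"
    "set w \<subseteq> S \<union> m_inv G ` S" "foldr (mult G) w \<one> = h2" by blast
  moreover have "S \<union> m_inv G ` S \<subseteq> carrier G" using assms(1) by auto
  ultimately show ?case
    by (intro exI[of _ "u @ w"]) (auto simp: foldr_mult_append subset_trans simp del: foldr_append)
qed

text \<open>A least word exists because every element of \<open>generate G S\<close> is the product of some word; without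
that, the \<open>LEAST\<close> in the definition of the word length would carry no information.\<close>

lemma word_of_word_length:
  assumes "group G" "finite_generating_set G S" "g \<in> carrier G"
  obtains w where "length w = word_length G S g" "set w \<subseteq> S \<union> m_inv G ` S"
    "foldr (mult G) w \<one>\<^bsub>G\<^esub> = g"
proof -
  have "\<exists>n w. length w = n \<and> set w \<subseteq> S \<union> m_inv G ` S \<and> foldr (mult G) w \<one>\<^bsub>G\<^esub> = g"
    using group.exists_word[OF assms(1), of S g] assms(2,3) unfolding finite_generating_set_def by auto
  from LeastI_ex[OF this] show ?thesis
    using that unfolding word_length_def by auto
qed

lemma finitely_generated_countable:
  assumes "finitely_generated_group G"
  shows "countable (carrier G)"
proof -
  obtain S where G: "group G" and S: "finite_generating_set G S"
    using assms unfolding finitely_generated_group_def by auto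
  have "carrier G \<subseteq> (\<lambda>w. foldr (mult G) w \<one>\<^bsub>G\<^esub>) ` lists (S \<union> m_inv G ` S)"
  proof
    fix g assume "g \<in> carrier G"
    from word_of_word_length[OF G S this] obtain w
      where "set w \<subseteq> S \<union> m_inv G ` S" "foldr (mult G) w \<one>\<^bsub>G\<^esub> = g" .
    then show "g \<in> (\<lambda>w. foldr (mult G) w \<one>\<^bsub>G\<^esub>) ` lists (S \<union> m_inv G ` S)"
      by (intro image_eqI[of _ _ w]) (simp_all add: lists_eq_set)
  qed
  moreover have "countable (lists (S \<union> m_inv G ` S))"
    using S by (intro countable_lists countable_finite finite_UnI finite_imageI)
      (simp_all add: finite_generating_set_def)
  ultimately show ?thesis
    by (rule countable_subset[OF _ countable_image])
qed

section \<open>The square norm as a non-negative integral\<close>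

text \<open>The squared norm, taken in \<open>[0, \<infinity>]\<close> and as an iterated integral over counting measures: it
makes sense for every family of functions, being finite is membership in \<open>ell2_sum G\<close>, and the
monotone forms of Fubini's theorem apply to it without integrability conditions.\<close>

definition ell2_mass :: "('g, 'a) monoid_scheme \<Rightarrow> (nat \<Rightarrow> 'g \<Rightarrow> complex) \<Rightarrow> ennreal" where
  "ell2_mass G \<xi> =
     (\<integral>\<^sup>+n. (\<integral>\<^sup>+x. ennreal ((cmod (\<xi> n x))\<^sup>2) \<partial>count_space (carrier G)) \<partial>count_space UNIV)"

lemma nn_integral_count_space_real:
  fixes f :: "'a \<Rightarrow> real"
  assumes "\<And>x. 0 \<le> f x"
  shows "f summable_on A \<longleftrightarrow> (\<integral>\<^sup>+x. ennreal (f x) \<partial>count_space A) < \<infinity>"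
    and "f summable_on A \<Longrightarrow> (\<integral>\<^sup>+x. ennreal (f x) \<partial>count_space A) = ennreal (infsum f A)"
proof -
  have eq: "f summable_on A \<longleftrightarrow> Infinite_Set_Sum.abs_summable_on f A"
    using abs_summable_equivalent[of f A] assms by simp
  show "f summable_on A \<longleftrightarrow> (\<integral>\<^sup>+x. ennreal (f x) \<partial>count_space A) < \<infinity>"
    unfolding eq abs_summable_on_def integrable_iff_bounded using assms by simp
  show "(\<integral>\<^sup>+x. ennreal (f x) \<partial>count_space A) = ennreal (infsum f A)" if "f summable_on A"
    using nn_integral_conv_infsetsum[of f A] infsetsum_infsum[of f A] that assms unfolding eq by simp
qed

lemma ell2_mass_eq:
  assumes "\<xi> \<in> ell2_sum G"
  shows "ell2_mass G \<xi> = ennreal ((ell2_sum_norm G \<xi>)\<^sup>2)"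
proof -
  let ?s = "\<lambda>n. (ell2_norm G (\<xi> n))\<^sup>2"
  have s: "summable ?s" "\<And>n. \<xi> n \<in> ell2 G" using assms by (auto simp: ell2_sum_def)
  have "(\<integral>\<^sup>+x. ennreal ((cmod (\<xi> n x))\<^sup>2) \<partial>count_space (carrier G)) = ennreal (?s n)" for n
    using s(2)[of n] unfolding ell2_norm_def ell2_def
    by (subst nn_integral_count_space_real(2)) (auto simp: infsum_nonneg)
  then have "ell2_mass G \<xi> = (\<Sum>n. ennreal (?s n))"
    unfolding ell2_mass_def by (simp add: nn_integral_count_space_nat)
  also have "\<dots> = ennreal (\<Sum>n. ?s n)"
    by (rule suminf_ennreal2) (use s in auto)
  finally show ?thesis
    using s by (simp add: ell2_sum_norm_def suminf_nonneg)
qed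

lemma ell2_sum_iff:
  "\<xi> \<in> ell2_sum G \<longleftrightarrow> (\<forall>n x. x \<notin> carrier G \<longrightarrow> \<xi> n x = 0) \<and> ell2_mass G \<xi> < \<infinity>"
proof
  assume "\<xi> \<in> ell2_sum G"
  then show "(\<forall>n x. x \<notin> carrier G \<longrightarrow> \<xi> n x = 0) \<and> ell2_mass G \<xi> < \<infinity>"
    using ell2_mass_eq[of \<xi> G] by (auto simp: ell2_sum_def ell2_def)
next
  assume *: "(\<forall>n x. x \<notin> carrier G \<longrightarrow> \<xi> n x = 0) \<and> ell2_mass G \<xi> < \<infinity>"
  let ?t = "\<lambda>n. \<integral>\<^sup>+x. ennreal ((cmod (\<xi> n x))\<^sup>2) \<partial>count_space (carrier G)"
  have fin: "(\<Sum>n. ?t n) < \<infinity>"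
    using * by (simp add: ell2_mass_def nn_integral_count_space_nat)
  then have "?t n < \<infinity>" for n
    by (metis ennreal_suminf_lessD infinity_ennreal_def)
  then have mem: "\<xi> n \<in> ell2 G" for n
    using * nn_integral_count_space_real(1)[of "\<lambda>x. (cmod (\<xi> n x))\<^sup>2" "carrier G"]
    by (auto simp: ell2_def)
  have "?t n = ennreal ((ell2_norm G (\<xi> n))\<^sup>2)" for n
    using mem[of n] unfolding ell2_norm_def ell2_def
    by (subst nn_integral_count_space_real(2)) (auto simp: infsum_nonneg)
  then have "summable (\<lambda>n. (ell2_norm G (\<xi> n))\<^sup>2)"
    using fin by (intro summable_suminf_not_top) auto
  then show "\<xi> \<in> ell2_sum G" using mem by (simp add: ell2_sum_def)
qed

lemma ell2_mass_mono2:
  assumes "\<And>n x. x \<in> carrier G \<Longrightarrow>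
     (cmod (\<zeta> n x))\<^sup>2 \<le> a * (cmod (\<xi> n x))\<^sup>2 + b * (cmod (\<eta> n x))\<^sup>2" "0 \<le> a" "0 \<le> b"
  shows "ell2_mass G \<zeta> \<le> ennreal a * ell2_mass G \<xi> + ennreal b * ell2_mass G \<eta>"
proof -
  have "ell2_mass G \<zeta> \<le> (\<integral>\<^sup>+n. (\<integral>\<^sup>+x. (ennreal a * ennreal ((cmod (\<xi> n x))\<^sup>2)
      + ennreal b * ennreal ((cmod (\<eta> n x))\<^sup>2)) \<partial>count_space (carrier G)) \<partial>count_space UNIV)"
    unfolding ell2_mass_def
  proof (intro nn_integral_mono)
    fix n x assume "x \<in> space (count_space (carrier G))"
    then have "ennreal ((cmod (\<zeta> n x))\<^sup>2) \<le> ennreal (a * (cmod (\<xi> n x))\<^sup>2 + b * (cmod (\<eta> n x))\<^sup>2)"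
      by (intro ennreal_leI assms) simp
    also have "\<dots> = ennreal a * ennreal ((cmod (\<xi> n x))\<^sup>2) + ennreal b * ennreal ((cmod (\<eta> n x))\<^sup>2)"
      using assms(2,3) by (simp add: ennreal_mult ennreal_plus)
    finally show "ennreal ((cmod (\<zeta> n x))\<^sup>2)
      \<le> ennreal a * ennreal ((cmod (\<xi> n x))\<^sup>2) + ennreal b * ennreal ((cmod (\<eta> n x))\<^sup>2)" .
  qed
  also have "\<dots> = ennreal a * ell2_mass G \<xi> + ennreal b * ell2_mass G \<eta>"
    by (simp add: ell2_mass_def nn_integral_add nn_integral_cmult)
  finally show ?thesis .
qed

text \<open>A pointwise substitute for Minkowski's inequality: the difference of the two sides is
\<open>(B u - A v)\<^sup>2 / (A B)\<close>. Integrated against functions of norms \<open>A\<close> and \<open>B\<close>, the right-hand side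
becomes \<open>(A + B)\<^sup>2\<close>, so the triangle inequality follows without the Cauchy-Schwarz inequality.\<close>

lemma weighted_square_le:
  fixes u v A B :: real
  assumes "0 < A" "0 < B"
  shows "(u + v)\<^sup>2 \<le> (1 + B / A) * u\<^sup>2 + (1 + A / B) * v\<^sup>2"
proof -
  have "(1 + B / A) * u\<^sup>2 + (1 + A / B) * v\<^sup>2 - (u + v)\<^sup>2 = (B * u - A * v)\<^sup>2 / (A * B)"
    using assms by (simp add: field_simps power2_eq_square)
  also have "\<dots> \<ge> 0" using assms by simp
  finally show ?thesis by simp
qed

lemma ell2_mass_add_weighted:
  assumes "0 < A" "0 < B"
  shows "ell2_mass G (\<xi> + \<eta>) \<le>
     ennreal (1 + B / A) * ell2_mass G \<xi> + ennreal (1 + A / B) * ell2_mass G \<eta>"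
proof (rule ell2_mass_mono2)
  fix n x
  have "(cmod ((\<xi> + \<eta>) n x))\<^sup>2 \<le> (cmod (\<xi> n x) + cmod (\<eta> n x))\<^sup>2"
    by (simp add: power_mono norm_triangle_ineq)
  also note weighted_square_le[OF assms]
  finally show "(cmod ((\<xi> + \<eta>) n x))\<^sup>2 \<le> (1 + B / A) * (cmod (\<xi> n x))\<^sup>2 + (1 + A / B) * (cmod (\<eta> n x))\<^sup>2" .
qed (use assms in auto)

lemma ell2_mass_minus [simp]: "ell2_mass G (- \<xi>) = ell2_mass G \<xi>"
  by (simp add: ell2_mass_def)

lemma ell2_sum_add: "\<xi> \<in> ell2_sum G \<Longrightarrow> \<eta> \<in> ell2_sum G \<Longrightarrow> \<xi> + \<eta> \<in> ell2_sum G"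
  using le_less_trans[OF ell2_mass_add_weighted[of 1 1 G \<xi> \<eta>], of \<infinity>]
  by (simp add: ell2_sum_iff ennreal_mult_less_top)

lemma ell2_sum_minus: "\<xi> \<in> ell2_sum G \<Longrightarrow> - \<xi> \<in> ell2_sum G"
  using ell2_mass_minus[of G \<xi>] by (auto simp: ell2_sum_iff)

lemma left_regular_sum_ell2:
  assumes "group G" "g \<in> carrier G" "\<xi> \<in> ell2_sum G"
  shows "left_regular_sum G g \<xi> \<in> ell2_sum G"
    and "ell2_mass G (left_regular_sum G g \<xi>) = ell2_mass G \<xi>"
proof -
  have "\<And>n. \<xi> n \<in> ell2 G" using assms(3) by (simp add: ell2_sum_def)
  note * = left_regular_ell2[OF assms(1,2) this]
  show 1: "left_regular_sum G g \<xi> \<in> ell2_sum G"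
    using assms(3) * by (simp add: left_regular_sum_def ell2_sum_def)
  have "ell2_sum_norm G (left_regular_sum G g \<xi>) = ell2_sum_norm G \<xi>"
    by (simp add: ell2_sum_norm_def left_regular_sum_def *)
  then show "ell2_mass G (left_regular_sum G g \<xi>) = ell2_mass G \<xi>"
    using ell2_mass_eq[OF 1] ell2_mass_eq[OF assms(3)] by simp
qed

lemma ell2_mass_le_iff:
  assumes "\<xi> \<in> ell2_sum G" "0 \<le> R"
  shows "ell2_sum_norm G \<xi> \<le> R \<longleftrightarrow> ell2_mass G \<xi> \<le> ennreal (R\<^sup>2)"
proof -
  have "0 \<le> ell2_sum_norm G \<xi>"
    using assms by (auto simp: ell2_sum_norm_def ell2_sum_def intro!: suminf_nonneg)
  then show ?thesis
    using assms by (simp add: ell2_mass_eq abs_le_square_iff[symmetric])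
qed

lemma ell2_mass_triangle:
  assumes "ell2_mass G \<xi> \<le> ennreal (A\<^sup>2)" "ell2_mass G \<eta> \<le> ennreal (B\<^sup>2)" "0 < A" "0 < B"
  shows "ell2_mass G (\<xi> + \<eta>) \<le> ennreal ((A + B)\<^sup>2)"
proof -
  have "ell2_mass G (\<xi> + \<eta>) \<le> ennreal (1 + B / A) * ennreal (A\<^sup>2) + ennreal (1 + A / B) * ennreal (B\<^sup>2)"
    by (rule order_trans[OF ell2_mass_add_weighted[OF assms(3,4)]])
       (intro add_mono mult_left_mono assms; simp)
  also have "\<dots> = ennreal ((1 + B / A) * A\<^sup>2 + (1 + A / B) * B\<^sup>2)"
    using assms by (simp add: ennreal_mult ennreal_plus)
  also have "(1 + B / A) * A\<^sup>2 + (1 + A / B) * B\<^sup>2 = (A + B)\<^sup>2"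
    using assms(3,4) by (simp add: field_simps power2_eq_square)
  finally show ?thesis .
qed

section \<open>Quasi-cocycles grow at most linearly\<close>

definition cocycle_defect ::
  "('g, 'a) monoid_scheme \<Rightarrow> ('g \<Rightarrow> nat \<Rightarrow> 'g \<Rightarrow> complex) \<Rightarrow> 'g \<Rightarrow> 'g \<Rightarrow> nat \<Rightarrow> 'g \<Rightarrow> complex" where
  "cocycle_defect G c g h = left_regular_sum G g (c h) - c (g \<otimes>\<^bsub>G\<^esub> h) + c g"

lemma cocycle_defect_ell2:
  assumes "group G" "\<And>g. g \<in> carrier G \<Longrightarrow> c g \<in> ell2_sum G" "g \<in> carrier G" "h \<in> carrier G"
  shows "cocycle_defect G c g h \<in> ell2_sum G"
proof -
  interpret group G by fact
  show ?thesis
    unfolding cocycle_defect_def diff_conv_add_uminus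
    by (intro ell2_sum_add ell2_sum_minus left_regular_sum_ell2 assms m_closed)
qed

text \<open>Multiplying a word by one more letter \<open>s\<close> changes the norm of the quasi-cocycle by at most
\<open>\<parallel>c s\<parallel> + K\<close>, because the representation is isometric; \<open>C\<close> bounds this quantity over the finitely
many letters.\<close>

lemma quasi_cocycle_growth:
  assumes G: "group G" and S: "finite_generating_set G S"
    and c: "\<And>g. g \<in> carrier G \<Longrightarrow> c g \<in> ell2_sum G"
    and K: "\<And>g h. g \<in> carrier G \<Longrightarrow> h \<in> carrier G \<Longrightarrow> ell2_mass G (cocycle_defect G c g h) \<le> ennreal (K\<^sup>2)"
    and "0 < K"
  obtains C D :: real where "0 < C" "0 < D"
    "\<And>g. g \<in> carrier G \<Longrightarrow> ell2_mass G (c g) \<le> ennreal ((C * word_length G S g + D)\<^sup>2)"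
proof -
  interpret group G by fact
  let ?T = "S \<union> m_inv G ` S"
  have T: "finite ?T" "?T \<subseteq> carrier G" using S by (auto simp: finite_generating_set_def)
  define N where "N = ell2_sum_norm G"
  have N: "ell2_mass G (c g) \<le> ennreal ((N (c g) + r)\<^sup>2)" if "g \<in> carrier G" "0 \<le> r" for g r
  proof -
    have "0 \<le> N (c g)"
      using c[OF that(1)] by (auto simp: N_def ell2_sum_norm_def ell2_sum_def intro!: suminf_nonneg)
    then show ?thesis
      using ell2_mass_le_iff[of "c g" G "N (c g) + r"] c that by (simp add: N_def)
  qed
  have Nnn: "0 \<le> N (c g)" if "g \<in> carrier G" for g
    using c[OF that(1)] by (auto simp: N_def ell2_sum_norm_def ell2_sum_def intro!: suminf_nonneg)
  \<comment> \<open>the summands \<open>1\<close> here and in \<open>D\<close> keep the radii positive, as the weighted inequality divides by them\<close>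
  define B where "B = (\<Sum>s\<in>?T. N (c s)) + 1"
  have B: "0 < B" unfolding B_def using Nnn T by (intro add_nonneg_pos sum_nonneg) auto
  have Bs: "ell2_mass G (c s) \<le> ennreal (B\<^sup>2)" if "s \<in> ?T" for s
  proof -
    have le: "N (c s) + 1 \<le> B" unfolding B_def using that T Nnn
      by (intro add_right_mono member_le_sum) auto
    have s: "s \<in> carrier G" using that T(2) by blast
    show ?thesis
      using N[of s 1] le Nnn[of s] s
      by (auto intro!: order_trans[OF N[of s 1]] ennreal_leI power_mono)
  qed
  define D where "D = N (c \<one>\<^bsub>G\<^esub>) + 1"
  have D: "0 < D" using Nnn[of "\<one>\<^bsub>G\<^esub>"] by (simp add: D_def)
  define C where "C = B + K"
  have C: "0 < C" using B \<open>0 < K\<close> by (simp add: C_def)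
  have words: "ell2_mass G (c (foldr (mult G) w \<one>\<^bsub>G\<^esub>)) \<le> ennreal ((C * length w + D)\<^sup>2)" if "set w \<subseteq> ?T" for w
    using that
  proof (induction w)
    case Nil
    show ?case using N[of "\<one>\<^bsub>G\<^esub>" 1] by (simp add: D_def)
  next
    case (Cons s w)
    let ?g = "foldr (mult G) w \<one>\<^bsub>G\<^esub>"
    have g: "?g \<in> carrier G" and s: "s \<in> carrier G" "s \<in> ?T"
      using Cons.prems T word_closed[of S w] S by (auto simp: finite_generating_set_def)
    have IH: "ell2_mass G (c ?g) \<le> ennreal ((C * length w + D)\<^sup>2)"
      using Cons by simp
    have "0 < C * length w + D" using C D by (simp add: add_nonneg_pos)
    moreover have "ell2_mass G (- cocycle_defect G c s ?g) \<le> ennreal (K\<^sup>2)"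
      using K[OF s(1) g] by simp
    moreover have "ell2_mass G (left_regular_sum G s (c ?g)) \<le> ennreal ((C * length w + D)\<^sup>2)"
      using IH left_regular_sum_ell2(2)[OF G s(1) c[OF g]] by simp
    ultimately have "ell2_mass G (left_regular_sum G s (c ?g) + c s + - cocycle_defect G c s ?g)
        \<le> ennreal ((C * length w + D + B + K)\<^sup>2)"
      using B \<open>0 < K\<close> Bs[OF s(2)] by (intro ell2_mass_triangle) auto
    also have "left_regular_sum G s (c ?g) + c s + - cocycle_defect G c s ?g = c (s \<otimes>\<^bsub>G\<^esub> ?g)"
      by (simp add: cocycle_defect_def)
    finally show ?case by (simp add: C_def algebra_simps)
  qed
  show ?thesis
  proof (rule that[OF C D])
    fix g assume "g \<in> carrier G"
    from word_of_word_length[OF G S this] show "ell2_mass G (c g) \<le> ennreal ((C * word_length G S g + D)\<^sup>2)"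
      using words by metis
  qed
qed

section \<open>Countable families in $L^2$ as families in $\ell^2$\<close>

lemma integrable_mult_of_squares:
  fixes f g :: "'x \<Rightarrow> real"
  assumes [measurable]: "f \<in> borel_measurable M" "g \<in> borel_measurable M"
    and "integrable M (\<lambda>x. (f x)\<^sup>2)" "integrable M (\<lambda>x. (g x)\<^sup>2)"
  shows "integrable M (\<lambda>x. f x * g x)"
proof (rule Bochner_Integration.integrable_bound)
  show "integrable M (\<lambda>x. (f x)\<^sup>2 + (g x)\<^sup>2)" using assms by simp
  have "\<bar>a * b\<bar> \<le> a\<^sup>2 + b\<^sup>2" for a b :: real
  proof -
    have "2 * \<bar>a * b\<bar> \<le> a\<^sup>2 + b\<^sup>2" using sum_squares_bound[of "\<bar>a\<bar>" "\<bar>b\<bar>"] by (simp add: abs_mult)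
    then show ?thesis by simp
  qed
  then show "AE x in M. norm (f x * g x) \<le> norm ((f x)\<^sup>2 + (g x)\<^sup>2)" by simp
qed simp

text \<open>Gram-Schmidt without normalisation: \<open>F s i\<close> is the component of \<open>f i\<close> orthogonal to
\<open>f 0, \<dots>, f (s - 1)\<close>, and \<open>K s\<close> is the Gram matrix of these components. Passing from \<open>s\<close> to
\<open>s + 1\<close> subtracts from \<open>K s\<close> the rank one matrix \<open>v i s * v j s\<close>, and \<open>K s i j\<close> vanishes once
\<open>s > i\<close>, so the rank one matrices add up to the Gram matrix of \<open>f\<close>. If \<open>F s s\<close> is null, then
\<open>K s s s = 0\<close> and the convention \<open>x / 0 = 0\<close> makes the step trivial, as it should be.\<close>

lemma gram_vectors:
  fixes f :: "nat \<Rightarrow> 'x \<Rightarrow> real"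
  assumes meas: "\<And>i. f i \<in> borel_measurable M"
    and sq: "\<And>i. integrable M (\<lambda>x. (f i x)\<^sup>2)"
  shows "\<exists>v :: nat \<Rightarrow> nat \<Rightarrow> real. (\<forall>i m. i < m \<longrightarrow> v i m = 0) \<and>
    (\<forall>i j N. i \<le> N \<longrightarrow> (\<Sum>m\<le>N. v i m * v j m) = (\<integral>x. f i x * f j x \<partial>M))"
proof -
  define F where "F = rec_nat f (\<lambda>s F i x. F i x - (\<integral>y. F i y * F s y \<partial>M) / (\<integral>y. F s y * F s y \<partial>M) * F s x)"
  define K where "K s i j = (\<integral>x. F s i x * F s j x \<partial>M)" for s i j
  have F0: "F 0 = f" by (simp add: F_def)
  have FS: "F (Suc s) i x = F s i x - K s i s / K s s s * F s s x" for s i x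
    by (simp add: F_def K_def)
  have FS': "F (Suc s) i = (\<lambda>x. F s i x - K s i s / K s s s * F s s x)" for s i
    by (rule ext) (rule FS)
  have F_meas [measurable]: "F s i \<in> borel_measurable M" for s i
    by (induction s arbitrary: i) (auto simp: F0 FS' meas)
  have F_sq: "integrable M (\<lambda>x. (F s i x)\<^sup>2)" for s i
  proof (induction s arbitrary: i)
    case 0
    show ?case by (simp add: F0 sq)
  next
    case (Suc s)
    have "integrable M (\<lambda>x. F s i x * F s s x)"
      by (intro integrable_mult_of_squares Suc F_meas)
    then have "integrable M (\<lambda>x. (F s i x)\<^sup>2 - 2 * (K s i s / K s s s) * (F s i x * F s s x)
        + (K s i s / K s s s)\<^sup>2 * (F s s x)\<^sup>2)"
      by (intro Bochner_Integration.integrable_add Bochner_Integration.integrable_diff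
          integrable_mult_right Suc)
    also have "(\<lambda>x. (F s i x)\<^sup>2 - 2 * (K s i s / K s s s) * (F s i x * F s s x)
        + (K s i s / K s s s)\<^sup>2 * (F s s x)\<^sup>2) = (\<lambda>x. (F (Suc s) i x)\<^sup>2)"
      unfolding FS by (simp only: power2_eq_square) (simp add: algebra_simps)
    finally show ?case .
  qed
  have F_prod: "integrable M (\<lambda>x. F s i x * F s j x)" for s i j
    by (intro integrable_mult_of_squares F_sq F_meas)
  have K_sym: "K s i j = K s j i" for s i j
    by (simp add: K_def mult.commute)
  have K_nn: "0 \<le> K s i i" for s i
    by (simp add: K_def)
  have K_null: "K s i j = 0" if "K s i i = 0" for s i j
  proof -
    have "AE x in M. F s i x * F s i x = 0"
      using that integral_nonneg_eq_0_iff_AE[OF F_prod[of s i i]] by (simp add: K_def)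
    then have "AE x in M. F s i x * F s j x = 0" by eventually_elim simp
    then show ?thesis by (simp add: K_def integral_eq_zero_AE)
  qed
  have K_Suc: "K (Suc s) i j = K s i j - K s i s * K s j s / K s s s" for s i j
  proof -
    define a b where "a = K s i s / K s s s" and "b = K s j s / K s s s"
    have "K (Suc s) i j = (\<integral>x. F s i x * F s j x - b * (F s i x * F s s x)
        - a * (F s j x * F s s x) + a * b * (F s s x * F s s x) \<partial>M)"
      unfolding K_def[of "Suc s"] FS a_def[symmetric] b_def[symmetric]
      by (intro Bochner_Integration.integral_cong) (auto simp: algebra_simps)
    also have "\<dots> = K s i j - b * K s i s - a * K s j s + a * b * K s s s"
      using F_prod by (simp add: K_def)
    also have "\<dots> = K s i j - K s i s * K s j s / K s s s"
      by (cases "K s s s = 0") (simp_all add: a_def b_def field_simps)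
    finally show ?thesis .
  qed
  have K_zero: "K s i j = 0" if "i < s" for s i j
    using that
  proof (induction s arbitrary: j)
    case (Suc s)
    show ?case
    proof (cases "i = s")
      case True
      then show ?thesis
        using K_null[of s s j] K_sym[of s j s] by (cases "K s s s = 0") (simp_all add: K_Suc)
    next
      case False
      then show ?thesis using Suc by (simp add: K_Suc)
    qed
  qed simp
  define v where "v i s = K s i s / sqrt (K s s s)" for i s
  have vv: "v i s * v j s = K s i s * K s j s / K s s s" for i j s
    using K_nn[of s s] by (simp add: v_def)
  have sum: "K 0 i j = (\<Sum>s<S. v i s * v j s) + K S i j" for i j S
    by (induction S) (simp_all add: vv K_Suc)
  show ?thesis
  proof (intro exI[of _ v] conjI allI impI)
    show "v i m = 0" if "i < m" for i m
      using that by (simp add: v_def K_zero)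
    show "(\<Sum>m\<le>N. v i m * v j m) = (\<integral>x. f i x * f j x \<partial>M)" if "i \<le> N" for i j N
      using sum[of i j "Suc N"] K_zero[of i "Suc N" j] that
      by (simp add: K_def F0 lessThan_Suc_atMost)
  qed
qed

text \<open>Equal Gram matrices give equal norms of all linear combinations; the defect of a quasi-cocycle is
a combination of this form, and the case \<open>a = b = c\<close> gives the norms of the single vectors.\<close>

lemma gram_vectors_three_term:
  fixes f :: "nat \<Rightarrow> 'x \<Rightarrow> real"
  assumes meas [measurable]: "\<And>i. f i \<in> borel_measurable M"
    and sq: "\<And>i. integrable M (\<lambda>x. (f i x)\<^sup>2)"
  shows "\<exists>v :: nat \<Rightarrow> nat \<Rightarrow> real. \<forall>a b c. (\<Sum>m. ennreal ((v a m - v b m + v c m)\<^sup>2))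
            = (\<integral>\<^sup>+x. ennreal ((f a x - f b x + f c x)\<^sup>2) \<partial>M)"
proof -
  obtain v :: "nat \<Rightarrow> nat \<Rightarrow> real"
    where v0: "\<And>i m. i < m \<Longrightarrow> v i m = 0"
      and v: "\<And>i j N. i \<le> N \<Longrightarrow> (\<Sum>m\<le>N. v i m * v j m) = (\<integral>x. f i x * f j x \<partial>M)"
    using gram_vectors[of f M, OF meas sq] by auto
  have I: "integrable M (\<lambda>x. f i x * f j x)" for i j
    by (intro integrable_mult_of_squares meas sq)
  have expand: "(p - q + r)\<^sup>2 = p * p + q * q + r * r - 2 * (p * q) - 2 * (q * r) + 2 * (p * r)"
    for p q r :: real by (simp add: power2_eq_square algebra_simps)
  show ?thesis
  proof (intro exI[of _ v] allI)
    fix a b c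
    let ?g = "\<lambda>m. (v a m - v b m + v c m)\<^sup>2"
    define N where "N = Max {a, b, c}"
    have N: "a \<le> N" "b \<le> N" "c \<le> N" by (auto simp: N_def)
    have "(\<Sum>m. ennreal (?g m)) = (\<Sum>m\<le>N. ennreal (?g m))"
      by (rule suminf_finite) (use N in \<open>auto simp: v0\<close>)
    also have "\<dots> = ennreal (\<Sum>m\<le>N. ?g m)"
      by (simp add: sum_ennreal)
    also have "(\<Sum>m\<le>N. ?g m) = (\<integral>x. (f a x - f b x + f c x)\<^sup>2 \<partial>M)"
    proof -
      have "(\<Sum>m\<le>N. ?g m) = (\<Sum>m\<le>N. v a m * v a m) + (\<Sum>m\<le>N. v b m * v b m)
        + (\<Sum>m\<le>N. v c m * v c m) - 2 * (\<Sum>m\<le>N. v a m * v b m)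
        - 2 * (\<Sum>m\<le>N. v b m * v c m) + 2 * (\<Sum>m\<le>N. v a m * v c m)"
        unfolding expand by (simp only: sum.distrib sum_subtractf sum_distrib_left)
      also have "\<dots> = (\<integral>x. (f a x - f b x + f c x)\<^sup>2 \<partial>M)"
        unfolding expand v[OF N(1)] v[OF N(2)] v[OF N(3)] by (simp add: I)
      finally show ?thesis .
    qed
    also have "ennreal \<dots> = (\<integral>\<^sup>+x. ennreal ((f a x - f b x + f c x)\<^sup>2) \<partial>M)"
    proof (rule nn_integral_eq_integral[symmetric])
      show "integrable M (\<lambda>x. (f a x - f b x + f c x)\<^sup>2)"
        unfolding expand by (simp add: I)
    qed simp
    finally show "(\<Sum>m. ennreal (?g m)) = (\<integral>\<^sup>+x. ennreal ((f a x - f b x + f c x)\<^sup>2) \<partial>M)" .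
  qed
qed

text \<open>This replaces an isometric embedding of the whole of \<open>L\<^sup>2 M\<close> into \<open>\<ell>\<^sup>2\<close>: the
quasi-cocycle involves only countably many functions, and Gram-Schmidt applies to these directly
instead of to an orthonormal basis. The real and imaginary parts are treated as
two members of a real family, at the indices \<open>2 t\<close> and \<open>2 t + 1\<close>.\<close>

lemma L2_family_in_ell2:
  fixes f :: "'i \<Rightarrow> 'x \<Rightarrow> complex"
  assumes "countable I"
    and meas: "\<And>i. i \<in> I \<Longrightarrow> f i \<in> borel_measurable M"
    and sq: "\<And>i. i \<in> I \<Longrightarrow> (\<integral>\<^sup>+x. ennreal ((cmod (f i x))\<^sup>2) \<partial>M) < \<infinity>"
  shows "\<exists>v :: 'i \<Rightarrow> nat \<Rightarrow> complex. \<forall>a\<in>I. \<forall>b\<in>I. \<forall>c\<in>I.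
     (\<Sum>m. ennreal ((cmod (v a m - v b m + v c m))\<^sup>2))
       = (\<integral>\<^sup>+x. ennreal ((cmod (f a x - f b x + f c x))\<^sup>2) \<partial>M)"
proof -
  define F where "F n = (let i = from_nat_into I n in if i \<in> I then f i else (\<lambda>_. 0))" for n
  have F: "F (to_nat_on I i) = f i" if "i \<in> I" for i
    using that \<open>countable I\<close> by (simp add: F_def)
  have F_meas [measurable]: "F n \<in> borel_measurable M" for n
    by (simp add: F_def Let_def meas)
  have F_sq: "(\<integral>\<^sup>+x. ennreal ((cmod (F n x))\<^sup>2) \<partial>M) < \<infinity>" for n
    using sq[of "from_nat_into I n"] by (simp add: F_def Let_def)
  have F_int: "integrable M (\<lambda>x. (cmod (F n x))\<^sup>2)" for n
    using F_sq[of n] by (simp add: integrable_iff_bounded)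
  define g where "g n x = (if even n then Re (F (n div 2) x) else Im (F (n div 2) x))" for n x
  have g_meas [measurable]: "g n \<in> borel_measurable M" for n
    by (cases "even n") (simp_all add: g_def[abs_def])
  have g_le: "(g n x)\<^sup>2 \<le> (cmod (F (n div 2) x))\<^sup>2" for n x
    by (simp add: g_def cmod_power2)
  have g_sq: "integrable M (\<lambda>x. (g n x)\<^sup>2)" for n
    by (rule Bochner_Integration.integrable_bound[OF F_int[of "n div 2"]]) (simp_all add: g_le)
  obtain w :: "nat \<Rightarrow> nat \<Rightarrow> real"
    where w: "\<And>a b c. (\<Sum>m. ennreal ((w a m - w b m + w c m)\<^sup>2))
            = (\<integral>\<^sup>+x. ennreal ((g a x - g b x + g c x)\<^sup>2) \<partial>M)"
    using gram_vectors_three_term[of g M, OF g_meas g_sq] by blast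
  define t where "t i = 2 * to_nat_on I i" for i
  define v where "v i m = Complex (w (t i) m) (w (Suc (t i)) m)" for i m
  have g_t: "g (t i) x = Re (f i x)" "g (Suc (t i)) x = Im (f i x)" if "i \<in> I" for i x
    using F[OF that] by (simp_all add: g_def t_def)
  have split: "ennreal ((cmod z)\<^sup>2) = ennreal ((Re z)\<^sup>2) + ennreal ((Im z)\<^sup>2)" for z
    by (simp add: cmod_power2 ennreal_plus)
  show ?thesis
  proof (intro exI[of _ v] ballI)
    fix a b c assume abc: "a \<in> I" "b \<in> I" "c \<in> I"
    have [measurable]: "f a \<in> borel_measurable M" "f b \<in> borel_measurable M" "f c \<in> borel_measurable M"
      using abc meas by auto
    have "(\<Sum>m. ennreal ((cmod (v a m - v b m + v c m))\<^sup>2))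
      = (\<Sum>m. ennreal ((w (t a) m - w (t b) m + w (t c) m)\<^sup>2))
        + (\<Sum>m. ennreal ((w (Suc (t a)) m - w (Suc (t b)) m + w (Suc (t c)) m)\<^sup>2))"
      by (simp add: split v_def suminf_add)
    also have "\<dots> = (\<integral>\<^sup>+x. ennreal ((cmod (f a x - f b x + f c x))\<^sup>2) \<partial>M)"
      by (simp add: w g_t abc split nn_integral_add)
    finally show "(\<Sum>m. ennreal ((cmod (v a m - v b m + v c m))\<^sup>2))
       = (\<integral>\<^sup>+x. ennreal ((cmod (f a x - f b x + f c x))\<^sup>2) \<partial>M)" .
  qed
qed

section \<open>Measure preserving actions and group-valued labels\<close>

lemma mp_actionD:
  assumes "mp_action G M act" "g \<in> carrier G"
  shows mp_action_measurable: "act g \<in> M \<rightarrow>\<^sub>M M"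
    and mp_action_distr: "distr M M (act g) = M"
    and mp_action_group_action: "group_action G (space M) act"
  using assms unfolding mp_action_def by blast+

lemma mp_action_space: "mp_action G M act \<Longrightarrow> g \<in> carrier G \<Longrightarrow> x \<in> space M \<Longrightarrow> act g x \<in> space M"
  by (rule measurable_space[OF mp_action_measurable])

lemma mp_action_mult:
  "mp_action G M act \<Longrightarrow> g \<in> carrier G \<Longrightarrow> h \<in> carrier G \<Longrightarrow> x \<in> space M \<Longrightarrow>
    act (g \<otimes>\<^bsub>G\<^esub> h) x = act g (act h x)"
  by (rule group_action.composition_rule[OF mp_action_group_action])

lemma mp_action_inv:
  "mp_action G M act \<Longrightarrow> g \<in> carrier G \<Longrightarrow> x \<in> space M \<Longrightarrow> act (inv\<^bsub>G\<^esub> g) (act g x) = x"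
  by (rule group_action.orbit_sym_aux[OF mp_action_group_action _ _ refl])

lemma mp_action_one:
  assumes "mp_action G M act" "group G" "x \<in> space M"
  shows "act \<one>\<^bsub>G\<^esub> x = x"
proof -
  have "act \<one>\<^bsub>G\<^esub> x = (\<lambda>x\<in>space M. x) x"
    using group_action.id_eq_one[of G "space M" act] assms(1) by (simp add: mp_action_def)
  then show ?thesis using assms(3) by simp
qed

lemma mp_action_nn_integral:
  assumes "mp_action G M act" "g \<in> carrier G" "F \<in> borel_measurable M"
  shows "(\<integral>\<^sup>+x. F (act g x) \<partial>M) = (\<integral>\<^sup>+x. F x \<partial>M)"
  using nn_integral_distr[OF mp_action_measurable[OF assms(1,2)], of F] assms
  by (simp add: mp_action_distr[OF assms(1,2)])

lemma mp_action_AE: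
  assumes "mp_action G M act" "g \<in> carrier G" "AE x in M. P x"
  shows "AE x in M. P (act g x)"
  by (rule AE_distrD[OF mp_action_measurable[OF assms(1,2)]])
     (simp only: mp_action_distr[OF assms(1,2)] assms(3))

text \<open>A decomposition \<open>\<Oplus>\<^sub>i \<chi>\<^bsub>A i\<^esub> (g i)\<close> of a map \<open>T\<close> is turned into a measurable choice \<open>\<alpha>\<close> of the group
element that implements \<open>T\<close> at a point: the value is \<open>g i\<close> on the domain of the \<open>i\<close>-th piece. That
domain is the preimage of \<open>A i\<close> under a measure preserving map, hence has the measure of \<open>A i\<close>.\<close>

lemma orthogonal_sum_label:
  fixes G :: "('g, 'a) monoid_scheme"
  assumes G: "group G" and act: "mp_action G M act"
    and sum: "orthogonal_sum G M act A g f" and f: "AE x in M. f x = Some (T x)"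
  shows "\<exists>\<alpha>. \<alpha> \<in> M \<rightarrow>\<^sub>M count_space (carrier G) \<and> (AE x in M. act (\<alpha> x) x = T x) \<and>
     (\<forall>\<phi>::'g \<Rightarrow> ennreal. (\<integral>\<^sup>+x. \<phi> (\<alpha> x) \<partial>M) = (\<Sum>i. \<phi> (g i) * emeasure M (A i)))"
proof -
  interpret group G by fact
  have A: "A i \<in> sets M" and g: "g i \<in> carrier G" for i
    using sum by (auto simp: orthogonal_sum_def)
  define D where "D i = act (g i) -` A i \<inter> space M" for i
  have D_dom: "dom (cut M act (A i) (g i)) = D i" for i
    by (auto simp: cut_def D_def dom_def split: if_splits)
  have D_sets [measurable]: "D i \<in> sets M" for i
    unfolding D_def by (rule measurable_sets[OF mp_action_measurable[OF act g] A])
  have D_em: "emeasure M (D i) = emeasure M (A i)" for i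
    using emeasure_distr[OF mp_action_measurable[OF act g] A, of i]
    by (simp add: mp_action_distr[OF act g] D_def)
  have D_disj: "disjoint_family D"
    using sum by (simp add: orthogonal_sum_def D_dom)
  have cover: "AE x in M. \<exists>i. x \<in> D i \<and> act (g i) x = T x"
  proof -
    have "AE x in M. \<forall>y. f x = Some y \<longleftrightarrow> (\<exists>i. cut M act (A i) (g i) x = Some y)"
      using sum by (simp add: orthogonal_sum_def)
    with f show ?thesis
    proof eventually_elim
      case (elim x)
      then obtain i where "cut M act (A i) (g i) x = Some (T x)" by blast
      then have "x \<in> space M \<and> act (g i) x \<in> A i \<and> act (g i) x = T x"
        by (simp add: cut_def split: if_splits)
      then show ?case by (auto simp: D_def)
    qed
  qed
  define \<alpha> where "\<alpha> x = (if \<exists>i. x \<in> D i then g (LEAST i. x \<in> D i) else \<one>\<^bsub>G\<^esub>)" for x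
  have \<alpha>_D: "\<alpha> x = g i" if "x \<in> D i" for x i
  proof -
    have "(LEAST i. x \<in> D i) = i"
      using that D_disj LeastI[of "\<lambda>i. x \<in> D i", OF that] by (auto simp: disjoint_family_on_def)
    then show ?thesis using that by (auto simp: \<alpha>_def)
  qed
  have \<alpha>_meas: "\<alpha> \<in> M \<rightarrow>\<^sub>M count_space (carrier G)"
  proof -
    have "(\<lambda>x. LEAST i. x \<in> D i) \<in> M \<rightarrow>\<^sub>M count_space UNIV" by measurable
    moreover have "g \<in> count_space UNIV \<rightarrow>\<^sub>M count_space (carrier G)" using g by simp
    ultimately have [measurable]: "(\<lambda>x. g (LEAST i. x \<in> D i)) \<in> M \<rightarrow>\<^sub>M count_space (carrier G)"
      by (rule measurable_compose)
    have [measurable]: "(\<lambda>x. \<one>\<^bsub>G\<^esub>) \<in> M \<rightarrow>\<^sub>M count_space (carrier G)" by simp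
    show ?thesis unfolding \<alpha>_def by measurable
  qed
  have "(\<integral>\<^sup>+x. \<phi> (\<alpha> x) \<partial>M) = (\<Sum>i. \<phi> (g i) * emeasure M (A i))" for \<phi> :: "'g \<Rightarrow> ennreal"
  proof -
    have "(\<integral>\<^sup>+x. \<phi> (\<alpha> x) \<partial>M) = (\<integral>\<^sup>+x. (\<Sum>i. \<phi> (g i) * indicator (D i) x) \<partial>M)"
    proof (rule nn_integral_cong_AE)
      show "AE x in M. \<phi> (\<alpha> x) = (\<Sum>i. \<phi> (g i) * indicator (D i) x)"
        using cover
      proof eventually_elim
        case (elim x)
        then obtain i where i: "x \<in> D i" by blast
        have "(\<Sum>j. \<phi> (g j) * indicator (D j) x) = (\<Sum>j\<in>{i}. \<phi> (g j) * indicator (D j) x)"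
          by (rule suminf_finite) (use i D_disj in \<open>auto simp: disjoint_family_on_def indicator_def\<close>)
        then show ?case using i by (simp add: \<alpha>_D)
      qed
    qed
    also have "\<dots> = (\<Sum>i. \<phi> (g i) * emeasure M (A i))"
      by (simp add: nn_integral_suminf nn_integral_cmult_indicator D_em)
    finally show ?thesis .
  qed
  moreover have "AE x in M. act (\<alpha> x) x = T x"
    using cover by eventually_elim (auto simp: \<alpha>_D)
  ultimately show ?thesis using \<alpha>_meas by blast
qed

lemma borel_measurable_nn_integral_count_space:
  fixes f :: "'i \<Rightarrow> 'x \<Rightarrow> ennreal"
  assumes "countable I" "\<And>i. i \<in> I \<Longrightarrow> f i \<in> borel_measurable M"
  shows "(\<lambda>x. \<integral>\<^sup>+i. f i x \<partial>count_space I) \<in> borel_measurable M"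
proof -
  interpret sigma_finite_measure "count_space I"
    by (rule sigma_finite_measure_count_space_countable) fact
  have "(\<lambda>p. f (snd p) (fst p)) \<in> borel_measurable (M \<Otimes>\<^sub>M count_space I)"
    by (rule measurable_compose_countable'[where I = I and g = snd])
       (use assms in \<open>auto intro: measurable_compose[OF measurable_fst]\<close>)
  from borel_measurable_nn_integral_fst[OF this] show ?thesis by simp
qed

section \<open>The cocycle of an orbit equivalence\<close>

text \<open>\<open>\<alpha>\<close> is the orbit cocycle \<open>H \<times> X \<rightarrow> G\<close>, determined almost everywhere by \<open>\<alpha>(h, x) x = h x\<close>. It is
a parameter, rather than defined by this property, so that it can be chosen measurable.\<close>

locale orbit_cocycle =
  fixes G :: "('g, 'a) monoid_scheme" and H :: "('h, 'b) monoid_scheme"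
    and M :: "'x measure" and actG :: "'g \<Rightarrow> 'x \<Rightarrow> 'x" and actH :: "'h \<Rightarrow> 'x \<Rightarrow> 'x"
    and \<alpha> :: "'h \<Rightarrow> 'x \<Rightarrow> 'g"
  assumes group_G: "group G" and group_H: "group H"
    and countable_G: "countable (carrier G)" and countable_H: "countable (carrier H)"
    and prob: "prob_space M"
    and actG: "mp_action G M actG" and actH: "mp_action H M actH"
    and free_G: "essentially_free G M actG" and free_H: "essentially_free H M actH"
    and same_orbits: "AE x in M. orbit G actG x = orbit H actH x"
    and label_measurable: "\<And>h. h \<in> carrier H \<Longrightarrow> \<alpha> h \<in> M \<rightarrow>\<^sub>M count_space (carrier G)"
    and label_AE: "\<And>h. h \<in> carrier H \<Longrightarrow> AE x in M. actG (\<alpha> h x) x = actH h x"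
begin

sublocale G: group G by (rule group_G)
sublocale H: group H by (rule group_H)
sublocale prob_space M by (rule prob)

lemma label_closed: "h \<in> carrier H \<Longrightarrow> x \<in> space M \<Longrightarrow> \<alpha> h x \<in> carrier G"
  using measurable_space[OF label_measurable] by simp

definition regular :: "'x \<Rightarrow> bool" where
  "regular x \<longleftrightarrow> (\<forall>g\<in>carrier G. actG g x = x \<longrightarrow> g = \<one>\<^bsub>G\<^esub>) \<and>
     (\<forall>h\<in>carrier H. actH h x = x \<longrightarrow> h = \<one>\<^bsub>H\<^esub>) \<and>
     orbit G actG x = orbit H actH x \<and> (\<forall>h\<in>carrier H. actG (\<alpha> h x) x = actH h x)"

text \<open>An \<open>H\<close>-invariant set of full measure on which every property assumed almost everywhere holds at
all points. Invariance is what allows the cocycle identity, which compares values at different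
points of an orbit, to be used pointwise.\<close>

definition good :: "'x \<Rightarrow> bool" where
  "good x \<longleftrightarrow> x \<in> space M \<and> (\<forall>k\<in>carrier H. regular (actH k x))"

lemma AE_good: "AE x in M. good x"
proof -
  have labels: "AE x in M. \<forall>h\<in>carrier H. actG (\<alpha> h x) x = actH h x"
    using label_AE by (simp add: AE_ball_countable countable_H)
  have "AE x in M. regular x"
    using free_G[unfolded essentially_free_def] free_H[unfolded essentially_free_def] same_orbits labels
    by eventually_elim (unfold regular_def, intro conjI)
  then have "AE x in M. \<forall>k\<in>carrier H. regular (actH k x)"
    by (intro AE_ball_countable[OF countable_H, THEN iffD2, OF ballI] mp_action_AE[OF actH])
  then show ?thesis using AE_space by eventually_elim (simp add: good_def)
qed

lemma good_space: "good x \<Longrightarrow> x \<in> space M"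
  by (simp add: good_def)

lemma good_act: "good x \<Longrightarrow> k \<in> carrier H \<Longrightarrow> good (actH k x)"
proof -
  assume x: "good x" and k: "k \<in> carrier H"
  have "regular (actH h (actH k x))" if "h \<in> carrier H" for h
    using x k that mp_action_mult[OF actH that k, of x] unfolding good_def by (metis H.m_closed)
  then show ?thesis
    using x k mp_action_space[OF actH k] by (simp add: good_def)
qed

lemma good_regular: "good x \<Longrightarrow> regular x"
proof -
  assume x: "good x"
  then have "regular (actH \<one>\<^bsub>H\<^esub> x)" unfolding good_def by blast
  then show ?thesis by (simp add: mp_action_one[OF actH group_H good_space[OF x]])
qed

lemma good_label: "good x \<Longrightarrow> h \<in> carrier H \<Longrightarrow> actG (\<alpha> h x) x = actH h x"
  using good_regular unfolding regular_def by blast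

lemma good_free_G:
  assumes "good x" "g \<in> carrier G" "g' \<in> carrier G" "actG g x = actG g' x"
  shows "g = g'"
proof -
  have "actG (inv\<^bsub>G\<^esub> g' \<otimes>\<^bsub>G\<^esub> g) x = x"
    using assms good_space mp_action_mult[OF actG] mp_action_inv[OF actG] by simp
  then have "inv\<^bsub>G\<^esub> g' \<otimes>\<^bsub>G\<^esub> g = \<one>\<^bsub>G\<^esub>"
    using good_regular[OF assms(1)] assms(2,3) unfolding regular_def by simp
  then show ?thesis
    using assms(2,3) by (metis G.inv_closed G.inv_equality G.inv_inv)
qed

lemma good_free_H:
  assumes "good x" "h \<in> carrier H" "h' \<in> carrier H" "actH h x = actH h' x"
  shows "h = h'"
proof -
  have "actH (inv\<^bsub>H\<^esub> h' \<otimes>\<^bsub>H\<^esub> h) x = x"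
    using assms good_space mp_action_mult[OF actH] mp_action_inv[OF actH] by simp
  then have "inv\<^bsub>H\<^esub> h' \<otimes>\<^bsub>H\<^esub> h = \<one>\<^bsub>H\<^esub>"
    using good_regular[OF assms(1)] assms(2,3) unfolding regular_def by simp
  then show ?thesis
    using assms(2,3) by (metis H.inv_closed H.inv_equality H.inv_inv)
qed

lemma label_mult:
  assumes "good x" "h \<in> carrier H" "k \<in> carrier H"
  shows "\<alpha> (h \<otimes>\<^bsub>H\<^esub> k) x = \<alpha> h (actH k x) \<otimes>\<^bsub>G\<^esub> \<alpha> k x"
proof (rule good_free_G[OF assms(1)])
  have x: "x \<in> space M" "actH k x \<in> space M"
    using assms good_act good_space by auto
  show "\<alpha> (h \<otimes>\<^bsub>H\<^esub> k) x \<in> carrier G" "\<alpha> h (actH k x) \<otimes>\<^bsub>G\<^esub> \<alpha> k x \<in> carrier G"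
    using assms x label_closed by auto
  show "actG (\<alpha> (h \<otimes>\<^bsub>H\<^esub> k) x) x = actG (\<alpha> h (actH k x) \<otimes>\<^bsub>G\<^esub> \<alpha> k x) x"
    using assms x
    by (simp add: good_label good_act mp_action_mult[OF actG] mp_action_mult[OF actH] label_closed)
qed

text \<open>Freeness of the \<open>H\<close>-action gives injectivity, equality of the orbits surjectivity.\<close>

lemma label_bij:
  assumes "good x"
  shows "bij_betw (\<lambda>h. \<alpha> h x) (carrier H) (carrier G)"
proof (rule bij_betw_imageI)
  show "inj_on (\<lambda>h. \<alpha> h x) (carrier H)"
    by (rule inj_onI) (metis assms good_label good_free_H)
  show "(\<lambda>h. \<alpha> h x) ` carrier H = carrier G"
  proof (intro equalityI subsetI)
    fix g assume g: "g \<in> carrier G"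
    have "actG g x \<in> orbit H actH x"
      using good_regular[OF assms] g unfolding regular_def orbit_def by blast
    then obtain h where h: "h \<in> carrier H" "actG g x = actH h x"
      unfolding orbit_def by blast
    then have "g = \<alpha> h x"
      using good_label[OF assms h(1)] g label_closed[OF h(1) good_space[OF assms]]
      by (intro good_free_G[OF assms]) auto
    then show "g \<in> (\<lambda>h. \<alpha> h x) ` carrier H" using h(1) by blast
  qed (use assms good_space label_closed in auto)
qed

lemma label_backward:
  assumes "good x" "k \<in> carrier H"
  shows "\<alpha> k (actH (inv\<^bsub>H\<^esub> k) x) = inv\<^bsub>G\<^esub> (\<alpha> (inv\<^bsub>H\<^esub> k) x)"
proof -
  have x: "x \<in> space M" "actH (inv\<^bsub>H\<^esub> k) x \<in> space M"
    using assms good_act good_space by auto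
  have "\<alpha> \<one>\<^bsub>H\<^esub> x = \<one>\<^bsub>G\<^esub>"
    using assms(1) x good_label[OF assms(1), of "\<one>\<^bsub>H\<^esub>"] label_closed
    by (intro good_free_G[OF assms(1)])
       (auto simp: mp_action_one[OF actG group_G] mp_action_one[OF actH group_H])
  then have "\<alpha> k (actH (inv\<^bsub>H\<^esub> k) x) \<otimes>\<^bsub>G\<^esub> \<alpha> (inv\<^bsub>H\<^esub> k) x = \<one>\<^bsub>G\<^esub>"
    using label_mult[of x k "inv\<^bsub>H\<^esub> k"] assms by simp
  then show ?thesis
    using assms x label_closed by (intro G.inv_equality[symmetric]) auto
qed

text \<open>By the cocycle identity \<open>\<alpha>(k, k\<inverse> x)\<close> is the inverse of \<open>\<alpha>(k\<inverse>, x)\<close>, so this map is the bijection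
\<open>h \<mapsto> \<alpha>(h, x)\<close> composed with the inversions of \<open>H\<close> and \<open>G\<close>.\<close>

lemma label_backward_bij:
  assumes "good x"
  shows "bij_betw (\<lambda>k. \<alpha> k (actH (inv\<^bsub>H\<^esub> k) x)) (carrier H) (carrier G)"
proof -
  have iH: "bij_betw (m_inv H) (carrier H) (carrier H)"
    by (rule bij_betw_byWitness[where f' = "m_inv H"]) auto
  have iG: "bij_betw (m_inv G) (carrier G) (carrier G)"
    by (rule bij_betw_byWitness[where f' = "m_inv G"]) auto
  have "bij_betw (m_inv G \<circ> ((\<lambda>h. \<alpha> h x) \<circ> m_inv H)) (carrier H) (carrier G)"
    by (rule bij_betw_trans[OF bij_betw_trans[OF iH label_bij[OF assms]] iG])
  then show ?thesis
    by (rule bij_betw_cong[THEN iffD1, rotated]) (simp add: label_backward assms)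
qed

section \<open>Untwisting the induced representation\<close>

text \<open>The induced representation of \<open>H\<close> lives on measurable fields \<open>\<xi>\<close> of vectors \<open>\<xi> x\<close> in
\<open>\<ell>\<^sup>2G\<^bsup>\<oplus>\<infinity>\<^esup>\<close>. A pair \<open>(x, g)\<close> stands for the pair of points \<open>(x, g\<inverse> x)\<close> of an orbit; writing it as
\<open>(k y, y)\<close> with \<open>k \<in> H\<close>, so that \<open>g = \<alpha>(k, y)\<close>, gives new coordinates \<open>(k, y)\<close>, in which \<open>H\<close>
acts by left translation of \<open>k\<close> alone.\<close>

definition untwist :: "('x \<Rightarrow> nat \<Rightarrow> 'g \<Rightarrow> complex) \<Rightarrow> 'h \<Rightarrow> nat \<Rightarrow> 'x \<Rightarrow> complex" where
  "untwist \<xi> k n y = \<xi> (actH k y) n (\<alpha> k y)"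

lemma untwist_measurable:
  assumes "\<And>n g. g \<in> carrier G \<Longrightarrow> (\<lambda>x. \<xi> x n g) \<in> borel_measurable M" "k \<in> carrier H"
  shows "untwist \<xi> k n \<in> borel_measurable M"
  unfolding untwist_def[abs_def]
  by (rule measurable_compose_countable'[OF _ label_measurable countable_G,
        where f = "\<lambda>g y. \<xi> (actH k y) n g"])
     (rule measurable_compose[OF mp_action_measurable[OF actH assms(2)] assms(1)] assms(2) | assumption)+

text \<open>For fixed \<open>k\<close> the substitution \<open>x = k y\<close> preserves the measure, and for fixed \<open>x\<close> the sum over
\<open>k\<close> becomes the sum over \<open>g = \<alpha>(k, k\<inverse> x)\<close>, which runs once through \<open>G\<close>.\<close>

lemma untwist_isometry:
  assumes \<xi>: "\<And>n g. g \<in> carrier G \<Longrightarrow> (\<lambda>x. \<xi> x n g) \<in> borel_measurable M"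
  shows "(\<integral>\<^sup>+n. (\<integral>\<^sup>+k. (\<integral>\<^sup>+y. ennreal ((cmod (untwist \<xi> k n y))\<^sup>2) \<partial>M) \<partial>count_space (carrier H))
             \<partial>count_space UNIV)
       = (\<integral>\<^sup>+x. ell2_mass G (\<xi> x) \<partial>M)"
proof -
  define F where "F k n x = ennreal ((cmod (\<xi> x n (\<alpha> k (actH (inv\<^bsub>H\<^esub> k) x))))\<^sup>2)" for k n x
  have F_meas [measurable]: "F k n \<in> borel_measurable M" if k: "k \<in> carrier H" for k n
  proof -
    have L: "(\<lambda>x. \<alpha> k (actH (inv\<^bsub>H\<^esub> k) x)) \<in> M \<rightarrow>\<^sub>M count_space (carrier G)"
      by (rule measurable_compose[OF mp_action_measurable[OF actH H.inv_closed[OF k]] label_measurable[OF k]])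
    have [measurable]: "(\<lambda>x. \<xi> x n (\<alpha> k (actH (inv\<^bsub>H\<^esub> k) x))) \<in> borel_measurable M"
      by (rule measurable_compose_countable'[OF \<xi> L countable_G])
    show ?thesis unfolding F_def[abs_def] by measurable
  qed
  have "(\<integral>\<^sup>+y. ennreal ((cmod (untwist \<xi> k n y))\<^sup>2) \<partial>M) = (\<integral>\<^sup>+x. F k n x \<partial>M)"
    if k: "k \<in> carrier H" for k n
  proof -
    have "(\<integral>\<^sup>+x. F k n x \<partial>M) = (\<integral>\<^sup>+y. F k n (actH k y) \<partial>M)"
      by (rule mp_action_nn_integral[OF actH k F_meas[OF k], symmetric])
    also have "\<dots> = (\<integral>\<^sup>+y. ennreal ((cmod (untwist \<xi> k n y))\<^sup>2) \<partial>M)"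
      by (rule nn_integral_cong) (simp add: F_def untwist_def mp_action_inv[OF actH k])
    finally show ?thesis by simp
  qed
  then have "(\<integral>\<^sup>+n. (\<integral>\<^sup>+k. (\<integral>\<^sup>+y. ennreal ((cmod (untwist \<xi> k n y))\<^sup>2) \<partial>M) \<partial>count_space (carrier H))
             \<partial>count_space UNIV)
     = (\<integral>\<^sup>+n. (\<integral>\<^sup>+k. (\<integral>\<^sup>+x. F k n x \<partial>M) \<partial>count_space (carrier H)) \<partial>count_space UNIV)"
    by (intro nn_integral_cong[where M = "count_space _"]) (simp only: space_count_space)
  also have "\<dots> = (\<integral>\<^sup>+n. (\<integral>\<^sup>+x. (\<integral>\<^sup>+k. F k n x \<partial>count_space (carrier H)) \<partial>M) \<partial>count_space UNIV)"
    by (intro nn_integral_cong nn_integral_count_space_nn_integral[symmetric] countable_H F_meas)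
  also have "\<dots> = (\<integral>\<^sup>+x. (\<integral>\<^sup>+n. (\<integral>\<^sup>+k. F k n x \<partial>count_space (carrier H)) \<partial>count_space UNIV) \<partial>M)"
    by (intro nn_integral_count_space_nn_integral[symmetric] borel_measurable_nn_integral_count_space
        countable_H F_meas) simp_all
  also have "\<dots> = (\<integral>\<^sup>+x. ell2_mass G (\<xi> x) \<partial>M)"
  proof (rule nn_integral_cong_AE)
    show "AE x in M. (\<integral>\<^sup>+n. (\<integral>\<^sup>+k. F k n x \<partial>count_space (carrier H)) \<partial>count_space UNIV)
      = ell2_mass G (\<xi> x)"
      using AE_good
    proof eventually_elim
      case (elim x)
      show ?case
        unfolding ell2_mass_def F_def
        using nn_integral_bij_count_space[OF label_backward_bij[OF elim], of "\<lambda>g. ennreal ((cmod (\<xi> x _ g))\<^sup>2)"]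
        by (intro nn_integral_cong) blast
    qed
  qed
  finally show ?thesis .
qed

end

section \<open>The transported quasi-cocycle\<close>

text \<open>Merges the coordinate \<open>n\<close> of \<open>\<ell>\<^sup>2G\<^bsup>\<oplus>\<infinity>\<^esup>\<close> and the coordinate \<open>m\<close> of the sequences that stand
for functions in \<open>L\<^sup>2 M\<close> into the single index of \<open>\<ell>\<^sup>2H\<^bsup>\<oplus>\<infinity>\<^esup>\<close>.\<close>

definition interleave :: "'h set \<Rightarrow> ('h \<Rightarrow> nat \<Rightarrow> nat \<Rightarrow> complex) \<Rightarrow> nat \<Rightarrow> 'h \<Rightarrow> complex" where
  "interleave X u m k = (if k \<in> X then u k (fst (prod_decode m)) (snd (prod_decode m)) else 0)"

lemma ell2_mass_interleave:
  assumes "countable (carrier H)"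
  shows "ell2_mass H (interleave (carrier H) u)
     = (\<integral>\<^sup>+n. (\<integral>\<^sup>+k. (\<Sum>m. ennreal ((cmod (u k n m))\<^sup>2)) \<partial>count_space (carrier H)) \<partial>count_space UNIV)"
proof -
  define \<phi> where "\<phi> p = (\<integral>\<^sup>+k. ennreal ((cmod (u k (fst p) (snd p)))\<^sup>2) \<partial>count_space (carrier H))" for p
  have "ell2_mass H (interleave (carrier H) u) = (\<integral>\<^sup>+m. \<phi> (prod_decode m) \<partial>count_space UNIV)"
    unfolding ell2_mass_def \<phi>_def
    by (intro nn_integral_cong) (simp add: interleave_def)
  also have "\<dots> = (\<integral>\<^sup>+p. \<phi> p \<partial>count_space UNIV)"
    by (rule nn_integral_bij_count_space[OF bij_prod_decode])
  also have "\<dots> = (\<integral>\<^sup>+n. (\<integral>\<^sup>+m. \<phi> (n, m) \<partial>count_space UNIV) \<partial>count_space UNIV)"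
    by (rule nn_integral_fst_count_space[symmetric])
  also have "\<dots> = (\<integral>\<^sup>+n. (\<integral>\<^sup>+k. (\<integral>\<^sup>+m. ennreal ((cmod (u k n m))\<^sup>2) \<partial>count_space UNIV)
        \<partial>count_space (carrier H)) \<partial>count_space UNIV)"
    unfolding \<phi>_def fst_conv snd_conv
    by (intro nn_integral_cong nn_integral_count_space_nn_integral assms) simp
  finally show ?thesis by (simp only: nn_integral_count_space_nat)
qed

context orbit_cocycle
begin

text \<open>The quasi-cocycle induced along \<open>\<alpha>\<close>, as a measurable field over \<open>X\<close>. The point is moved back by
\<open>h\<close> since \<open>H\<close> acts on fields by \<open>(h \<cdot> \<xi>) x = \<lambda>(\<alpha>(h, h\<inverse> x)) (\<xi> (h\<inverse> x))\<close>.\<close>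

definition transport :: "('g \<Rightarrow> nat \<Rightarrow> 'g \<Rightarrow> complex) \<Rightarrow> 'h \<Rightarrow> 'x \<Rightarrow> nat \<Rightarrow> 'g \<Rightarrow> complex" where
  "transport c h x = c (\<alpha> h (actH (inv\<^bsub>H\<^esub> h) x))"

lemma label_backward_measurable:
  assumes "h \<in> carrier H" "k \<in> carrier H"
  shows "(\<lambda>x. \<alpha> h (actH k x)) \<in> M \<rightarrow>\<^sub>M count_space (carrier G)"
  by (rule measurable_compose[OF mp_action_measurable[OF actH assms(2)] label_measurable[OF assms(1)]])

lemma transport_measurable:
  assumes "h \<in> carrier H"
  shows "(\<lambda>x. transport c h x n g) \<in> borel_measurable M"
  unfolding transport_def
  by (rule measurable_compose[OF label_backward_measurable[OF assms H.inv_closed[OF assms]],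
        of "\<lambda>a. c a n g"]) simp

lemma transport_mass:
  assumes "h \<in> carrier H"
  shows "(\<integral>\<^sup>+x. ell2_mass G (transport c h x) \<partial>M) = (\<integral>\<^sup>+x. ell2_mass G (c (\<alpha> h x)) \<partial>M)"
  unfolding transport_def
  by (rule mp_action_nn_integral[OF actH H.inv_closed[OF assms], of "\<lambda>x. ell2_mass G (c (\<alpha> h x))"],
      rule measurable_compose[OF label_measurable[OF assms], of "\<lambda>a. ell2_mass G (c a)"]) simp

definition transport_defect ::
  "('g \<Rightarrow> nat \<Rightarrow> 'g \<Rightarrow> complex) \<Rightarrow> 'h \<Rightarrow> 'h \<Rightarrow> 'x \<Rightarrow> nat \<Rightarrow> 'g \<Rightarrow> complex" where
  "transport_defect c h h' x = cocycle_defect G c (\<alpha> h (actH (inv\<^bsub>H\<^esub> h) x))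
     (\<alpha> h' (actH (inv\<^bsub>H\<^esub> (h \<otimes>\<^bsub>H\<^esub> h')) x))"

lemma transport_defect_measurable:
  assumes h: "h \<in> carrier H" "h' \<in> carrier H"
  shows "(\<lambda>x. transport_defect c h h' x n g) \<in> borel_measurable M"
  unfolding transport_defect_def
proof (rule measurable_compose_countable'[OF _ label_backward_measurable[OF h(1)] countable_G])
  fix a assume "a \<in> carrier G"
  show "(\<lambda>x. cocycle_defect G c a (\<alpha> h' (actH (inv\<^bsub>H\<^esub> (h \<otimes>\<^bsub>H\<^esub> h')) x)) n g) \<in> borel_measurable M"
    by (rule measurable_compose[OF label_backward_measurable[OF h(2)],
          of _ "\<lambda>b. cocycle_defect G c a b n g"]) (use h in simp_all)
qed (use h in simp)

text \<open>With \<open>x = k y\<close>, the defect of the untwisted family at \<open>(h, h')\<close> is, at each single point, a defect of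
\<open>c\<close>, taken at \<open>\<alpha>(h, h\<inverse> x)\<close> and \<open>\<alpha>(h', (h h')\<inverse> x)\<close>, because the product of these two elements
is \<open>\<alpha>(h h', (h h')\<inverse> x)\<close>. Hence a bound for the defect of \<open>c\<close> is a uniform bound here. Replacing
\<open>k\<close> by \<open>h\<inverse> k\<close> multiplies \<open>\<alpha>(k, y)\<close> from the left by the inverse of \<open>\<alpha>(h, h\<inverse> x)\<close>, which is
the left regular representation of \<open>G\<close> at the latter element.\<close>

lemma untwist_defect:
  assumes y: "good y" and h: "h \<in> carrier H" "h' \<in> carrier H" and k: "k \<in> carrier H"
  shows "untwist (transport c h') (inv\<^bsub>H\<^esub> h \<otimes>\<^bsub>H\<^esub> k) n y
       - untwist (transport c (h \<otimes>\<^bsub>H\<^esub> h')) k n y + untwist (transport c h) k n y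
     = untwist (transport_defect c h h') k n y"
proof -
  define x where "x = actH k y"
  define z where "z = actH (inv\<^bsub>H\<^esub> h) x"
  define w where "w = actH (inv\<^bsub>H\<^esub> (h \<otimes>\<^bsub>H\<^esub> h')) x"
  have good: "good x" "good z" "good w"
    unfolding w_def z_def x_def using y h k by (auto intro!: good_act)
  note [simp] = mp_action_mult[OF actH, symmetric] good_space[OF good(1)] good_space[OF y]
  have z: "actH (inv\<^bsub>H\<^esub> h \<otimes>\<^bsub>H\<^esub> k) y = z"
    unfolding z_def x_def using h k by simp
  have w: "actH (inv\<^bsub>H\<^esub> h') z = w" "actH h' w = z"
    unfolding z_def w_def using h by (simp_all add: H.inv_mult_group flip: H.m_assoc)
  have mult: "\<alpha> (h \<otimes>\<^bsub>H\<^esub> h') w = \<alpha> h z \<otimes>\<^bsub>G\<^esub> \<alpha> h' w"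
    using label_mult[OF good(3) h] by (simp only: w)
  have cl: "\<alpha> h z \<in> carrier G" "\<alpha> k y \<in> carrier G" "\<alpha> (inv\<^bsub>H\<^esub> h \<otimes>\<^bsub>H\<^esub> k) y \<in> carrier G"
    using h k good y by (auto intro!: label_closed good_space)
  have "\<alpha> k y = \<alpha> h z \<otimes>\<^bsub>G\<^esub> \<alpha> (inv\<^bsub>H\<^esub> h \<otimes>\<^bsub>H\<^esub> k) y"
    using label_mult[OF y h(1), of "inv\<^bsub>H\<^esub> h \<otimes>\<^bsub>H\<^esub> k"] h k by (simp only: z) (simp flip: H.m_assoc)
  then have shift: "\<alpha> (inv\<^bsub>H\<^esub> h \<otimes>\<^bsub>H\<^esub> k) y = inv\<^bsub>G\<^esub> (\<alpha> h z) \<otimes>\<^bsub>G\<^esub> \<alpha> k y"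
    using cl by (simp flip: G.m_assoc)
  show ?thesis
    unfolding untwist_def transport_def transport_defect_def cocycle_defect_def z shift
    by (simp only: x_def[symmetric] z_def[symmetric] w_def[symmetric] w mult)
       (simp add: left_regular_sum_def left_regular_def cl)
qed

text \<open>Suppose that more than \<open>2 |F|\<close> elements \<open>h\<close> have \<open>\<integral> \<parallel>c(\<alpha>(h, x))\<parallel>\<^sup>2 dx \<le> R\<close>, where \<open>F\<close> is the finite set
of \<open>g\<close> with \<open>\<parallel>c g\<parallel>\<^sup>2 \<le> 2 R\<close>. The elements \<open>\<alpha>(h, x)\<close> are distinct for almost every \<open>x\<close>, so at most
\<open>|F|\<close> of them lie in \<open>F\<close>, and more than half of the integrands exceed \<open>2 R\<close>; the sum of the integrals
is then too large.\<close>

lemma transport_proper: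
  assumes c: "finite {g \<in> carrier G. ell2_mass G (c g) \<le> ennreal (2 * R)}" and "0 < R"
  shows "finite {h \<in> carrier H. (\<integral>\<^sup>+x. ell2_mass G (c (\<alpha> h x)) \<partial>M) \<le> ennreal R}" (is "finite ?P")
proof (rule ccontr)
  define F where "F = {g \<in> carrier G. ell2_mass G (c g) \<le> ennreal (2 * R)}"
  assume "infinite ?P"
  then obtain Q where Q: "Q \<subseteq> ?P" "finite Q" "card Q = 2 * card F + 1"
    using infinite_arbitrarily_large by blast
  have meas: "(\<lambda>x. ell2_mass G (c (\<alpha> h x))) \<in> borel_measurable M" if "h \<in> Q" for h
    by (rule measurable_compose[OF label_measurable, of _ "\<lambda>a. ell2_mass G (c a)"]) (use Q that in auto)
  have pointwise: "AE x in M. ennreal (2 * R * (card F + 1)) \<le> (\<Sum>h\<in>Q. ell2_mass G (c (\<alpha> h x)))"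
    using AE_good
  proof eventually_elim
    case (elim x)
    define B where "B = {h \<in> Q. \<alpha> h x \<in> F}"
    have "inj_on (\<lambda>h. \<alpha> h x) B"
      by (rule inj_on_subset[OF bij_betw_imp_inj_on[OF label_bij[OF elim]]]) (use Q B_def in auto)
    then have "card B \<le> card F"
      by (rule card_inj_on_le) (use c in \<open>auto simp: B_def F_def\<close>)
    moreover have "card (Q - B) = card Q - card B"
      using Q(2) by (intro card_Diff_subset) (auto simp: B_def)
    ultimately have "real (card F + 1) \<le> real (card (Q - B))" using Q(3) by simp
    then have "2 * R * real (card F + 1) \<le> 2 * R * real (card (Q - B))"
      using \<open>0 < R\<close> by (intro mult_left_mono) auto
    then have "ennreal (2 * R * (card F + 1)) \<le> ennreal (2 * R * real (card (Q - B)))"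
      by (rule ennreal_leI)
    also have "\<dots> = (\<Sum>h\<in>Q - B. ennreal (2 * R))"
      using \<open>0 < R\<close> by (simp add: ennreal_mult mult.commute ennreal_of_nat_eq_real_of_nat)
    also have "\<dots> \<le> (\<Sum>h\<in>Q - B. ell2_mass G (c (\<alpha> h x)))"
    proof (rule sum_mono)
      fix h assume "h \<in> Q - B"
      moreover from this have "\<alpha> h x \<in> carrier G"
        using Q(1) label_closed[OF _ good_space[OF elim]] by auto
      ultimately show "ennreal (2 * R) \<le> ell2_mass G (c (\<alpha> h x))"
        by (auto simp: B_def F_def)
    qed
    also have "\<dots> \<le> (\<Sum>h\<in>Q. ell2_mass G (c (\<alpha> h x)))"
      by (rule sum_mono2) (use Q in auto)
    finally show ?case .
  qed
  have "ennreal (2 * R * (card F + 1)) = (\<integral>\<^sup>+x. ennreal (2 * R * (card F + 1)) \<partial>M)"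
    by (simp add: emeasure_space_1)
  also have "\<dots> \<le> (\<integral>\<^sup>+x. (\<Sum>h\<in>Q. ell2_mass G (c (\<alpha> h x))) \<partial>M)"
    by (rule nn_integral_mono_AE[OF pointwise])
  also have "\<dots> = (\<Sum>h\<in>Q. \<integral>\<^sup>+x. ell2_mass G (c (\<alpha> h x)) \<partial>M)"
    by (rule nn_integral_sum[OF meas])
  also have "\<dots> \<le> (\<Sum>h\<in>Q. ennreal R)"
    by (rule sum_mono) (use Q in auto)
  also have "\<dots> = ennreal (R * card Q)"
    using \<open>0 < R\<close> by (simp add: ennreal_mult mult.commute ennreal_of_nat_eq_real_of_nat)
  finally have "2 * R * (card F + 1) \<le> R * card Q"
    using \<open>0 < R\<close> by (simp add: ennreal_le_iff)
  then show False using \<open>0 < R\<close> by (simp add: Q(3) algebra_simps)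
qed

text \<open>The untwisted family has countably many members in \<open>L\<^sup>2 M\<close>, one for each \<open>(h, k, n)\<close>, and replacing
them by sequences with the same Gram matrix yields vectors in \<open>\<ell>\<^sup>2H\<^bsup>\<oplus>\<infinity>\<^esup>\<close>. Norms and defects are
unchanged, as both are norms of combinations of at most three members.\<close>

theorem induced_proper_quasi_cocycle:
  assumes c: "\<And>g. g \<in> carrier G \<Longrightarrow> c g \<in> ell2_sum G"
    and K: "\<And>g g'. g \<in> carrier G \<Longrightarrow> g' \<in> carrier G \<Longrightarrow> ell2_mass G (cocycle_defect G c g g') \<le> ennreal (K\<^sup>2)"
    and "0 \<le> K"
    and proper: "\<And>R. finite {g \<in> carrier G. ell2_mass G (c g) \<le> ennreal R}"
    and sq: "\<And>h. h \<in> carrier H \<Longrightarrow> (\<integral>\<^sup>+x. ell2_mass G (c (\<alpha> h x)) \<partial>M) < \<infinity>"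
  shows "admits_proper_quasi_cocycle H"
proof -
  define f where "f = (\<lambda>(h, k, n). untwist (transport c h) k n)"
  define I where "I = carrier H \<times> carrier H \<times> (UNIV :: nat set)"
  have f_norm: "(\<integral>\<^sup>+n. (\<integral>\<^sup>+k. (\<integral>\<^sup>+y. ennreal ((cmod (f (h, k, n) y))\<^sup>2) \<partial>M) \<partial>count_space (carrier H))
             \<partial>count_space UNIV) = (\<integral>\<^sup>+x. ell2_mass G (c (\<alpha> h x)) \<partial>M)" if "h \<in> carrier H" for h
    using untwist_isometry[of "transport c h", OF transport_measurable[OF that]]
    by (simp add: f_def transport_mass that)
  have "\<exists>v :: 'h \<times> 'h \<times> nat \<Rightarrow> nat \<Rightarrow> complex. \<forall>a\<in>I. \<forall>b\<in>I. \<forall>d\<in>I.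
     (\<Sum>m. ennreal ((cmod (v a m - v b m + v d m))\<^sup>2))
       = (\<integral>\<^sup>+y. ennreal ((cmod (f a y - f b y + f d y))\<^sup>2) \<partial>M)"
  proof (rule L2_family_in_ell2)
    show "countable I" unfolding I_def using countable_H by simp
    fix i assume "i \<in> I"
    then obtain h k n where i: "i = (h, k, n)" "h \<in> carrier H" "k \<in> carrier H"
      by (auto simp: I_def)
    show "f i \<in> borel_measurable M"
      using untwist_measurable[OF transport_measurable[OF i(2)] i(3)] by (simp add: f_def i)
    let ?F = "\<lambda>n k. \<integral>\<^sup>+y. ennreal ((cmod (f (h, k, n) y))\<^sup>2) \<partial>M"
    have "?F n k \<le> (\<integral>\<^sup>+k. ?F n k \<partial>count_space (carrier H))"
      by (rule nn_integral_ge_point) fact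
    also have "\<dots> \<le> (\<integral>\<^sup>+n. (\<integral>\<^sup>+k. ?F n k \<partial>count_space (carrier H)) \<partial>count_space UNIV)"
      by (rule nn_integral_ge_point) simp
    also have "\<dots> < \<infinity>" using f_norm[OF i(2)] sq[OF i(2)] by simp
    finally show "(\<integral>\<^sup>+y. ennreal ((cmod (f i y))\<^sup>2) \<partial>M) < \<infinity>" by (simp add: i)
  qed
  then obtain v :: "'h \<times> 'h \<times> nat \<Rightarrow> nat \<Rightarrow> complex"
    where v: "\<forall>a\<in>I. \<forall>b\<in>I. \<forall>d\<in>I. (\<Sum>m. ennreal ((cmod (v a m - v b m + v d m))\<^sup>2))
       = (\<integral>\<^sup>+y. ennreal ((cmod (f a y - f b y + f d y))\<^sup>2) \<partial>M)" by blast
  define d where "d h = interleave (carrier H) (\<lambda>k n. v (h, k, n))" for h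
  have d_mass: "ell2_mass H (d h) = (\<integral>\<^sup>+x. ell2_mass G (c (\<alpha> h x)) \<partial>M)" if h: "h \<in> carrier H" for h
  proof -
    have "(\<Sum>m. ennreal ((cmod (v (h, k, n) m))\<^sup>2)) = (\<integral>\<^sup>+y. ennreal ((cmod (f (h, k, n) y))\<^sup>2) \<partial>M)"
      if "k \<in> carrier H" for k n
    proof -
      have "(h, k, n) \<in> I" using h that by (simp add: I_def)
      from v[THEN bspec, OF this, THEN bspec, OF this, THEN bspec, OF this] show ?thesis by simp
    qed
    then have "ell2_mass H (d h) = (\<integral>\<^sup>+n. (\<integral>\<^sup>+k. (\<integral>\<^sup>+y. ennreal ((cmod (f (h, k, n) y))\<^sup>2) \<partial>M)
        \<partial>count_space (carrier H)) \<partial>count_space UNIV)"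
      unfolding d_def ell2_mass_interleave[OF countable_H]
      by (intro nn_integral_cong[where M = "count_space _"]) (simp only: space_count_space)
    then show ?thesis using f_norm[OF h] by simp
  qed
  have d_mem: "d h \<in> ell2_sum H" if "h \<in> carrier H" for h
    using d_mass[OF that] sq[OF that] by (simp add: ell2_sum_iff d_def interleave_def)
  have d_defect: "ell2_mass H (cocycle_defect H d h h') \<le> ennreal (K\<^sup>2)"
    if h: "h \<in> carrier H" "h' \<in> carrier H" for h h'
  proof -
    have "cocycle_defect H d h h' = interleave (carrier H) (\<lambda>k n m.
        v (h', inv\<^bsub>H\<^esub> h \<otimes>\<^bsub>H\<^esub> k, n) m - v (h \<otimes>\<^bsub>H\<^esub> h', k, n) m + v (h, k, n) m)"
      using h by (intro ext)
        (simp add: cocycle_defect_def d_def interleave_def left_regular_sum_def left_regular_def)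
    then have "ell2_mass H (cocycle_defect H d h h') = (\<integral>\<^sup>+n. (\<integral>\<^sup>+k. (\<Sum>m. ennreal ((cmod (
        v (h', inv\<^bsub>H\<^esub> h \<otimes>\<^bsub>H\<^esub> k, n) m - v (h \<otimes>\<^bsub>H\<^esub> h', k, n) m + v (h, k, n) m))\<^sup>2))
        \<partial>count_space (carrier H)) \<partial>count_space UNIV)"
      by (simp add: ell2_mass_interleave[OF countable_H])
    also have "\<dots> = (\<integral>\<^sup>+n. (\<integral>\<^sup>+k. (\<integral>\<^sup>+y. ennreal ((cmod (untwist (transport_defect c h h') k n y))\<^sup>2) \<partial>M)
        \<partial>count_space (carrier H)) \<partial>count_space UNIV)"
    proof (intro nn_integral_cong[where M = "count_space _"])
      fix n k assume "k \<in> space (count_space (carrier H))"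
      then have k: "k \<in> carrier H" by simp
      have I: "(h', inv\<^bsub>H\<^esub> h \<otimes>\<^bsub>H\<^esub> k, n) \<in> I" "(h \<otimes>\<^bsub>H\<^esub> h', k, n) \<in> I" "(h, k, n) \<in> I"
        using h k by (simp_all add: I_def)
      have "(\<Sum>m. ennreal ((cmod (v (h', inv\<^bsub>H\<^esub> h \<otimes>\<^bsub>H\<^esub> k, n) m - v (h \<otimes>\<^bsub>H\<^esub> h', k, n) m + v (h, k, n) m))\<^sup>2))
        = (\<integral>\<^sup>+y. ennreal ((cmod (f (h', inv\<^bsub>H\<^esub> h \<otimes>\<^bsub>H\<^esub> k, n) y - f (h \<otimes>\<^bsub>H\<^esub> h', k, n) y + f (h, k, n) y))\<^sup>2) \<partial>M)"
        by (rule v[THEN bspec, OF I(1), THEN bspec, OF I(2), THEN bspec, OF I(3)])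
      also have "\<dots> = (\<integral>\<^sup>+y. ennreal ((cmod (untwist (transport_defect c h h') k n y))\<^sup>2) \<partial>M)"
      proof (rule nn_integral_cong_AE)
        show "AE y in M. ennreal ((cmod (f (h', inv\<^bsub>H\<^esub> h \<otimes>\<^bsub>H\<^esub> k, n) y - f (h \<otimes>\<^bsub>H\<^esub> h', k, n) y + f (h, k, n) y))\<^sup>2)
          = ennreal ((cmod (untwist (transport_defect c h h') k n y))\<^sup>2)"
          using AE_good by eventually_elim (simp add: f_def untwist_defect h k)
      qed
      finally show "(\<Sum>m. ennreal ((cmod (v (h', inv\<^bsub>H\<^esub> h \<otimes>\<^bsub>H\<^esub> k, n) m - v (h \<otimes>\<^bsub>H\<^esub> h', k, n) m + v (h, k, n) m))\<^sup>2))
        = (\<integral>\<^sup>+y. ennreal ((cmod (untwist (transport_defect c h h') k n y))\<^sup>2) \<partial>M)" .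
    qed
    also have "\<dots> = (\<integral>\<^sup>+x. ell2_mass G (transport_defect c h h' x) \<partial>M)"
      by (rule untwist_isometry[OF transport_defect_measurable[OF h]])
    also have "\<dots> \<le> (\<integral>\<^sup>+x. ennreal (K\<^sup>2) \<partial>M)"
      unfolding transport_defect_def
      by (intro nn_integral_mono K label_closed mp_action_space[OF actH] H.inv_closed H.m_closed h)
    also have "\<dots> = ennreal (K\<^sup>2)" by (simp add: emeasure_space_1)
    finally show ?thesis .
  qed
  have "quasi_cocycle H (ell2_sum H) (ell2_sum_norm H) (left_regular_sum H) d"
    unfolding quasi_cocycle_def
  proof (intro conjI exI[of _ K] ballI d_mem)
    fix h h' assume h: "h \<in> carrier H" "h' \<in> carrier H"
    have "ell2_sum_norm H (cocycle_defect H d h h') \<le> K"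
      using d_defect[OF h] \<open>0 \<le> K\<close>
      by (simp add: ell2_mass_le_iff cocycle_defect_ell2[where c = d, OF group_H d_mem h])
    then show "ell2_sum_norm H (left_regular_sum H h (d h') - d (h \<otimes>\<^bsub>H\<^esub> h') + d h) \<le> K"
      by (simp only: cocycle_defect_def)
  qed
  moreover have "proper_map H (ell2_sum_norm H) d"
    unfolding proper_map_def
  proof (intro allI impI)
    fix R :: real assume "0 < R"
    then have "{h \<in> carrier H. ell2_sum_norm H (d h) \<le> R}
        = {h \<in> carrier H. (\<integral>\<^sup>+x. ell2_mass G (c (\<alpha> h x)) \<partial>M) \<le> ennreal (R\<^sup>2)}"
      using ell2_mass_le_iff[OF d_mem] d_mass by auto
    then show "finite {h \<in> carrier H. ell2_sum_norm H (d h) \<le> R}"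
      using transport_proper[OF proper, of "R\<^sup>2"] \<open>0 < R\<close> by simp
  qed
  ultimately show ?thesis unfolding admits_proper_quasi_cocycle_def by blast
qed

end

section \<open>Closure under $\ell^2$-orbit equivalence\<close>

text \<open>This is where the \<open>\<ell>\<^sup>2\<close>-condition enters: a function on \<open>G\<close> that grows at most like the square of
the word length is integrable along the labels of an element of \<open>X \<rtimes>\<^sub>2 G\<close>. The generating set comes
with the element, so the growth is required for each of them.\<close>

lemma crossed2_label:
  fixes G :: "('g, 'a) monoid_scheme"
  assumes G: "group G" and "prob_space M" and act: "mp_action G M act"
    and f: "f \<in> crossed2 M G act" "AE x in M. f x = Some (T x)"
    and growth: "\<And>S. finite_generating_set G S \<Longrightarrow> \<exists>C D::real. 0 < C \<and> 0 < D \<and>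
       (\<forall>g\<in>carrier G. \<phi> g \<le> ennreal ((C * real (word_length G S g) + D)\<^sup>2))"
  shows "\<exists>\<alpha>. \<alpha> \<in> M \<rightarrow>\<^sub>M count_space (carrier G) \<and> (AE x in M. act (\<alpha> x) x = T x) \<and>
     (\<integral>\<^sup>+x. \<phi> (\<alpha> x) \<partial>M) < \<infinity>"
proof -
  interpret prob_space M by fact
  obtain S A g where S: "finite_generating_set G S" and sum: "orthogonal_sum G M act A g f"
    and summ: "summable (\<lambda>i. measure M (A i) * (real (word_length G S (g i)))\<^sup>2)"
    using f(1) unfolding crossed2_def by blast
  obtain C D :: real where CD: "0 < C" "0 < D"
    "\<And>g. g \<in> carrier G \<Longrightarrow> \<phi> g \<le> ennreal ((C * real (word_length G S g) + D)\<^sup>2)"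
    using growth[OF S] by blast
  obtain \<alpha> where \<alpha>: "\<alpha> \<in> M \<rightarrow>\<^sub>M count_space (carrier G)" "AE x in M. act (\<alpha> x) x = T x"
    "(\<integral>\<^sup>+x. \<phi> (\<alpha> x) \<partial>M) = (\<Sum>i. \<phi> (g i) * emeasure M (A i))"
    using orthogonal_sum_label[OF G act sum f(2)] by metis
  have A: "\<And>i. A i \<in> sets M" "disjoint_family A" and g: "\<And>i. g i \<in> carrier G"
    using sum by (auto simp: orthogonal_sum_def)
  \<comment> \<open>\<open>(C l + D)\<^sup>2 \<le> 2 (C l)\<^sup>2 + 2 D\<^sup>2\<close>; the second part is summable as the \<open>A i\<close> are disjoint\<close>
  define r where "r i = 2 * C\<^sup>2 * (measure M (A i) * (real (word_length G S (g i)))\<^sup>2)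
     + 2 * D\<^sup>2 * measure M (A i)" for i
  have "summable (\<lambda>i. measure M (A i))"
    using sums_summable[OF finite_measure_UNION[OF _ A(2)]] A(1) by blast
  then have r: "summable r"
    unfolding r_def by (intro summable_add summable_mult summ)
  have "(\<Sum>i. \<phi> (g i) * emeasure M (A i)) \<le> (\<Sum>i. ennreal (r i))"
  proof (intro suminf_le summableI)
    fix i
    let ?l = "real (word_length G S (g i))"
    have "\<phi> (g i) * emeasure M (A i) \<le> ennreal ((C * ?l + D)\<^sup>2) * ennreal (measure M (A i))"
      using CD(3)[OF g] by (intro mult_mono) (auto simp: emeasure_eq_measure)
    also have "\<dots> = ennreal ((C * ?l + D)\<^sup>2 * measure M (A i))"
      by (simp add: ennreal_mult)
    also have "\<dots> \<le> ennreal (r i)"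
    proof (rule ennreal_leI)
      have "(C * ?l + D)\<^sup>2 \<le> 2 * (C * ?l)\<^sup>2 + 2 * D\<^sup>2"
        using weighted_square_le[of 1 1 "C * ?l" D] by simp
      then have "(C * ?l + D)\<^sup>2 * measure M (A i) \<le> (2 * (C * ?l)\<^sup>2 + 2 * D\<^sup>2) * measure M (A i)"
        by (intro mult_right_mono) auto
      then show "(C * ?l + D)\<^sup>2 * measure M (A i) \<le> r i"
        by (simp add: r_def algebra_simps power_mult_distrib)
    qed
    finally show "\<phi> (g i) * emeasure M (A i) \<le> ennreal (r i)" .
  qed
  also have "\<dots> = ennreal (\<Sum>i. r i)"
    by (rule suminf_ennreal2[OF _ r]) (simp add: r_def)
  also have "\<dots> < \<infinity>" by simp
  finally show ?thesis using \<alpha> by auto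
qed

theorem theorem5p10:
  fixes G :: "'g monoid" and H :: "'h monoid"
  assumes "finitely_generated_group G" and "finitely_generated_group H"
    and "l2_orbit_equivalent TYPE('x) G H"
    and "admits_proper_quasi_cocycle G"
  shows "admits_proper_quasi_cocycle H"
proof -
  have G: "group G" and H: "group H"
    using assms(1,2) by (auto simp: finitely_generated_group_def)
  obtain c K0 where c: "\<And>g. g \<in> carrier G \<Longrightarrow> c g \<in> ell2_sum G"
    and K0: "\<And>g h. g \<in> carrier G \<Longrightarrow> h \<in> carrier G \<Longrightarrow> ell2_sum_norm G (cocycle_defect G c g h) \<le> K0"
    and proper: "\<And>R. 0 < R \<Longrightarrow> finite {g \<in> carrier G. ell2_sum_norm G (c g) \<le> R}"
    using assms(4) unfolding admits_proper_quasi_cocycle_def quasi_cocycle_def proper_map_def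
      cocycle_defect_def by blast
  define K where "K = max K0 1"
  have K: "0 < K" "K0 \<le> K" by (auto simp: K_def)
  have defect: "ell2_mass G (cocycle_defect G c g h) \<le> ennreal (K\<^sup>2)"
    if "g \<in> carrier G" "h \<in> carrier G" for g h
  proof -
    have "ell2_sum_norm G (cocycle_defect G c g h) \<le> K"
      using K0[OF that] K by simp
    then show ?thesis
      using K by (simp add: ell2_mass_le_iff cocycle_defect_ell2[where c = c, OF G c that])
  qed
  have finite_balls: "finite {g \<in> carrier G. ell2_mass G (c g) \<le> ennreal R}" for R
  proof (rule finite_subset[OF _ proper])
    let ?r = "sqrt \<bar>R\<bar> + 1"
    show "0 < ?r" by (simp add: add_nonneg_pos)
    have "\<bar>R\<bar> \<le> ?r\<^sup>2" by (simp add: power2_sum)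
    then have "R \<le> ?r\<^sup>2" by simp
    then show "{g \<in> carrier G. ell2_mass G (c g) \<le> ennreal R}
        \<subseteq> {g \<in> carrier G. ell2_sum_norm G (c g) \<le> ?r}"
      using ell2_mass_le_iff[OF c, of _ ?r] by (auto intro: order_trans[OF _ ennreal_leI])
  qed
  obtain M :: "'x measure" and actG actH where oe: "l2_orbit_equivalence M G actG H actH"
    using assms(3) unfolding l2_orbit_equivalent_def by blast
  then have M: "prob_space M" and actG: "mp_action G M actG" and actH: "mp_action H M actH"
    and free: "essentially_free G M actG" "essentially_free H M actH"
    and orbits: "AE x in M. orbit G actG x = orbit H actH x"
    and nat: "\<And>h. h \<in> carrier H \<Longrightarrow> natural_map M actH h \<in> crossed2 M G actG"
    unfolding l2_orbit_equivalence_def orbit_equivalence_def standard_probability_space_def by auto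
  have "\<forall>h\<in>carrier H. \<exists>\<alpha>. \<alpha> \<in> M \<rightarrow>\<^sub>M count_space (carrier G) \<and>
      (AE x in M. actG (\<alpha> x) x = actH h x) \<and> (\<integral>\<^sup>+x. ell2_mass G (c (\<alpha> x)) \<partial>M) < \<infinity>"
  proof (rule ballI)
    fix h assume h: "h \<in> carrier H"
    show "\<exists>\<alpha>. \<alpha> \<in> M \<rightarrow>\<^sub>M count_space (carrier G) \<and>
      (AE x in M. actG (\<alpha> x) x = actH h x) \<and> (\<integral>\<^sup>+x. ell2_mass G (c (\<alpha> x)) \<partial>M) < \<infinity>"
    proof (rule crossed2_label[OF G M actG nat[OF h]])
      show "AE x in M. natural_map M actH h x = Some (actH h x)"
        using AE_space by eventually_elim
          (simp add: natural_map_def cut_def mp_action_space[OF actH h])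
      show "\<exists>C D::real. 0 < C \<and> 0 < D \<and> (\<forall>g\<in>carrier G.
          ell2_mass G (c g) \<le> ennreal ((C * real (word_length G S g) + D)\<^sup>2))"
        if "finite_generating_set G S" for S
        by (rule quasi_cocycle_growth[where c = c and K = K, OF G that c defect K(1)]) blast+
    qed
  qed
  from bchoice[OF this] obtain \<alpha> where \<alpha>: "\<And>h. h \<in> carrier H \<Longrightarrow> \<alpha> h \<in> M \<rightarrow>\<^sub>M count_space (carrier G)"
    "\<And>h. h \<in> carrier H \<Longrightarrow> AE x in M. actG (\<alpha> h x) x = actH h x"
    "\<And>h. h \<in> carrier H \<Longrightarrow> (\<integral>\<^sup>+x. ell2_mass G (c (\<alpha> h x)) \<partial>M) < \<infinity>"
    by blast
  interpret orbit_cocycle G H M actG actH \<alpha>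
    by (rule orbit_cocycle.intro[OF G H finitely_generated_countable[OF assms(1)]
          finitely_generated_countable[OF assms(2)] M actG actH free orbits \<alpha>(1,2)])
  show ?thesis
    by (rule induced_proper_quasi_cocycle[of c K, OF c defect less_imp_le[OF K(1)] finite_balls \<alpha>(3)])
qed

end
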